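(* Let $\mu\in\mathbb{R}^3$, let $\Sigma\in\mathbb{R}^{3\times 3}$ be symmetric positive definite, and let $\sigma>0$. Let $(X_i)_{i\ge 1}$ be a sequence of independent and identically distributed random vectors of $\mathbb{R}^3$ whose common probability density function is the ellipsoidal density $f$ with parameters $(\mu,\Sigma,\sigma)$ in dimension $d=3$. Define, from the sample $X_1,\dots,X_n$, $$\overline{X}_n=\frac1n\sum_{i=1}^n X_i,\qquad \widehat{\Sigma}_n=\frac3n\sum_{i=1}^n (X_i-\overline{X}_n)(X_i-\overline{X}_n)^T,$$ $$\widehat{\sigma}_n^2=\frac1n\sum_{j=1}^n\widehat{\xi}_j^{\,2}-\Big(\frac1n\sum_{j=1}^n\widehat{\xi}_j\Big)^2,\qquad \widehat{\xi}_j=\sqrt{(X_j-\overline{X}_n)^T\,\widehat{\Sigma}_n^{-1}\,(X_j-\overline{X}_n)}.$$ Let $$\Sigma_*=\frac{J_4(\sigma)}{J_2(\sigma)}\,\Sigma,\qquad \widetilde{\sigma}^2=\frac{J_4(\sigma)J_2(\sigma)-J_3(\sigma)^2}{J_4(\sigma)J_2(\sigma)},\qquad a_n=\sqrt{\frac{\log\log n}{n}}.$$ Then, as $n\to\infty$, $$\|\overline{X}_n-\mu\|=O(a_n)\ \text{ a.s.},\qquad \|\widehat{\Sigma}_n-\Sigma_*\|=O(a_n)\ \text{ a.s.},\qquad |\widehat{\sigma}_n^2-\widetilde{\sigma}^2|=O(a_n)\ \text{ a.s.}$$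
   Context: For $q\in\mathbb{N}$ and $\alpha>0$, $J_q(\alpha)=\int_0^\infty t^q\exp\left(-\frac{(t-1)^2}{2\alpha^2}\right)dt$. The ellipsoidal density on $\mathbb{R}^d$ with parameters $\mu\in\mathbb{R}^d$, $\Sigma\in\mathbb{R}^{d\times d}$ symmetric positive definite and $\sigma>0$ is $$f(x)=C_d\exp\left(-\frac{1}{2\sigma^2}\left(\sqrt{(x-\mu)^T\Sigma^{-1}(x-\mu)}-1\right)^2\right),\qquad C_d=\frac{\Gamma(d/2)}{2\pi^{d/2}\,|\Sigma|^{1/2}\,J_{d-1}(\sigma)},$$ where $|\Sigma|$ is the determinant of $\Sigma$ and $\Gamma$ is the Gamma function. $\|\cdot\|$ is the Euclidean norm for vectors and the associated operator (spectral) norm for matrices. A statement $Z_n=O(a_n)$ a.s. means that almost surely there is a (random) finite constant $C$ and a (random) index $n_0$ such that $|Z_n|\le C a_n$ for all $n\ge n_0$; in particular $\widehat{\sigma}_n^2$ need only be defined (i.e. $\widehat\Sigma_n$ invertible) for all sufficiently large $n$, almost surely. *)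

theory Defs
  imports "HOL-Probability.Probability" "HOL-Library.Landau_Symbols"
begin

definition J_int :: "nat \<Rightarrow> real \<Rightarrow> real" where
  "J_int q \<alpha> = (LBINT t:{0..}. t ^ q * exp (- (t - 1)\<^sup>2 / (2 * \<alpha>\<^sup>2)))"

definition sym_pos_def :: "real ^ 'd ^ 'd \<Rightarrow> bool" where
  "sym_pos_def S \<longleftrightarrow> transpose S = S \<and> (\<forall>x. x \<noteq> 0 \<longrightarrow> x \<bullet> (S *v x) > 0)"

text \<open>The Mahalanobis-type length \<open>sqrt (y\<^sup>T S\<^sup>-\<^sup>1 y)\<close>.  It is meaningful only for invertible \<open>S\<close>, since
  \<^const>\<open>matrix_inv\<close> of a singular matrix is unspecified.\<close>

definition inv_norm :: "real ^ 'd ^ 'd \<Rightarrow> real ^ 'd \<Rightarrow> real" where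
  "inv_norm S y = sqrt (y \<bullet> (matrix_inv S *v y))"

definition ellipsoidal_const :: "real ^ 'd ^ 'd \<Rightarrow> real \<Rightarrow> real" where
  "ellipsoidal_const S \<sigma> =
     Gamma (real CARD('d) / 2) /
       (2 * pi powr (real CARD('d) / 2) * sqrt (det S) * J_int (CARD('d) - 1) \<sigma>)"

definition ellipsoidal_density ::
    "real ^ 'd \<Rightarrow> real ^ 'd ^ 'd \<Rightarrow> real \<Rightarrow> real ^ 'd \<Rightarrow> real" where
  "ellipsoidal_density \<mu> S \<sigma> x =
     ellipsoidal_const S \<sigma> * exp (- (1 / (2 * \<sigma>\<^sup>2)) * (inv_norm S (x - \<mu>) - 1)\<^sup>2)"

definition outer_prod :: "real ^ 'd \<Rightarrow> real ^ 'd \<Rightarrow> real ^ 'd ^ 'd" where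
  "outer_prod x y = (\<chi> i j. x $ i * y $ j)"

text \<open>The spectral norm.  The library's \<^const>\<open>norm\<close> on \<^typ>\<open>real ^ 'd ^ 'd\<close> is the Frobenius norm.\<close>

definition spectral_norm :: "real ^ 'd ^ 'd \<Rightarrow> real" where
  "spectral_norm A = onorm (\<lambda>v. A *v v)"

text \<open>The estimators as functions of a sequence of observations \<open>x 1, x 2, \<dots>\<close> (\<open>x 0\<close> is never used).\<close>

definition sample_mean :: "(nat \<Rightarrow> real ^ 3) \<Rightarrow> nat \<Rightarrow> real ^ 3" where
  "sample_mean x n = (1 / real n) *\<^sub>R (\<Sum>i=1..n. x i)"

definition Sigma_hat :: "(nat \<Rightarrow> real ^ 3) \<Rightarrow> nat \<Rightarrow> real ^ 3 ^ 3" where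
  "Sigma_hat x n =
     (3 / real n) *\<^sub>R (\<Sum>i=1..n. outer_prod (x i - sample_mean x n) (x i - sample_mean x n))"

definition xi_hat :: "(nat \<Rightarrow> real ^ 3) \<Rightarrow> nat \<Rightarrow> nat \<Rightarrow> real" where
  "xi_hat x n j = inv_norm (Sigma_hat x n) (x j - sample_mean x n)"

definition sigma_sq_hat :: "(nat \<Rightarrow> real ^ 3) \<Rightarrow> nat \<Rightarrow> real" where
  "sigma_sq_hat x n =
     (1 / real n) * (\<Sum>j=1..n. (xi_hat x n j)\<^sup>2) - ((1 / real n) * (\<Sum>j=1..n. xi_hat x n j))\<^sup>2"

definition Sigma_star :: "real ^ 3 ^ 3 \<Rightarrow> real \<Rightarrow> real ^ 3 ^ 3" where
  "Sigma_star S \<sigma> = (J_int 4 \<sigma> / J_int 2 \<sigma>) *\<^sub>R S"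

definition sigma_sq_tilde :: "real \<Rightarrow> real" where
  "sigma_sq_tilde \<sigma> =
     (J_int 4 \<sigma> * J_int 2 \<sigma> - (J_int 3 \<sigma>)\<^sup>2) / (J_int 4 \<sigma> * J_int 2 \<sigma>)"

text \<open>At \<open>n \<le> 2\<close> the values are artefacts of the totalised \<^const>\<open>ln\<close> and \<^const>\<open>sqrt\<close>.\<close>

definition lil_rate :: "nat \<Rightarrow> real" where
  "lil_rate n = sqrt (ln (ln (real n)) / real n)"

end

theory Submission
  imports Defs "HOL-Real_Asymp.Real_Asymp"
begin

text \<open>
  If \<open>Y\<^sub>i\<close> are independent, centred and have a bounded exponential moment, then
  \<open>E exp (l Y\<^sub>i) \<le> exp (c l\<^sup>2)\<close> for small \<open>l\<close>.  An exponential maximal inequality on the blocks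
  \<open>n \<le> 2\<^sup>k\<close> with \<open>l = sqrt (ln k / 2\<^sup>k)\<close> and the Borel-Cantelli lemma give the upper half of the law of
  the iterated logarithm.  The centred observation \<open>y = X - \<mu>\<close> has a density depending only on
  \<open>N y = inv_norm S y\<close>.  As \<open>N\<close> is homogeneous of degree one, its image of Lebesgue measure has density
  proportional to \<open>r\<^sup>2\<close>, so the moments of \<open>N y\<close> are ratios of the integrals \<open>J\<close>; invariance under
  the linear involutions preserving \<open>N\<close> makes the mean vanish and the covariance proportional to \<open>S\<close>.
  The law of the iterated logarithm thus applies to the coordinates of \<open>y\<close>, their products and \<open>N y\<close>, and the
  three estimators are Lipschitz functions of these averages: the squared residuals average exactly to
  \<open>1\<close>, and replacing \<open>Sigma_hat\<close> and the sample mean by their limits changes each residual by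
  at most a multiple of the errors.
\<close>

section \<open>The upper half of the law of the iterated logarithm\<close>

lemma (in prob_space) nn_integral_indep_mult:
  fixes U V :: "'a \<Rightarrow> ennreal"
  assumes "indep_var borel U borel V"
  shows "(\<integral>\<^sup>+\<omega>. U \<omega> * V \<omega> \<partial>M) = (\<integral>\<^sup>+\<omega>. U \<omega> \<partial>M) * (\<integral>\<^sup>+\<omega>. V \<omega> \<partial>M)"
proof -
  have "indep_vars (\<lambda>_. borel) (case_bool U V) UNIV"
    using assms unfolding indep_var_def
    by (subst indep_vars_cong[where M'="\<lambda>_. borel" and N'="case_bool borel borel" and Y="case_bool U V" and J=UNIV]) (auto split: bool.split)
  then have "(\<integral>\<^sup>+\<omega>. (\<Prod>b\<in>UNIV. case_bool U V b \<omega>) \<partial>M) = (\<Prod>b\<in>UNIV. \<integral>\<^sup>+\<omega>. case_bool U V b \<omega> \<partial>M)"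
    by (intro indep_vars_nn_integral) auto
  then show ?thesis
    by (simp add: UNIV_bool mult.commute)
qed

text \<open>The exponential of \<open>l\<close> times the partial sum, frozen at the first index,
  zero included, at which the partial sum reaches \<open>a\<close>. The recursion takes the place of
  a stopping time: whether the factor with \<open>g (Suc n)\<close> enters is decided by
  \<open>g 1, ..., g n\<close> alone.\<close>

primrec stopped_exp :: "real \<Rightarrow> real \<Rightarrow> nat \<Rightarrow> (nat \<Rightarrow> real) \<Rightarrow> real" where
  "stopped_exp l a 0 g = 1"
| "stopped_exp l a (Suc n) g =
     (if \<exists>k\<le>n. a \<le> (\<Sum>i=1..k. g i) then stopped_exp l a n g
      else stopped_exp l a n g * exp (l * g (Suc n)))"

lemma stopped_exp_nonneg: "0 \<le> stopped_exp l a n g"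
  by (induction n) auto

lemma stopped_exp_before_hit:
  assumes "\<And>k. k < n \<Longrightarrow> (\<Sum>i=1..k. g i) < a"
  shows "stopped_exp l a n g = exp (l * (\<Sum>i=1..n. g i))"
  using assms
proof (induction n)
  case (Suc n)
  then have hit: "(\<exists>k\<le>n. a \<le> (\<Sum>i=1..k. g i)) = False"
    by (metis less_Suc_eq_le not_le)
  moreover have "stopped_exp l a n g = exp (l * (\<Sum>i=1..n. g i))"
    using Suc by simp
  ultimately show ?case
    unfolding stopped_exp.simps hit by (simp add: exp_add[symmetric] algebra_simps)
qed simp

text \<open>At the first hit the value is still the plain exponential of a partial sum that is at
  least \<open>a\<close>; afterwards it no longer changes.\<close>

lemma stopped_exp_after_hit:
  assumes "0 \<le> l" "\<exists>k\<le>n. a \<le> (\<Sum>i=1..k. g i)"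
  shows "exp (l * a) \<le> stopped_exp l a n g"
  using assms(2)
proof (induction n)
  case 0
  \<comment> \<open>The empty sum reaches \<open>a\<close> only if \<open>a \<le> 0\<close>, and
    then \<open>exp (l * a) \<le> 1\<close>.\<close>
  then show ?case using assms(1) by (simp add: mult_nonneg_nonpos)
next
  case (Suc n)
  show ?case
  proof (cases "\<exists>k\<le>n. a \<le> (\<Sum>i=1..k. g i)")
    case True
    then show ?thesis using Suc by simp
  next
    case False
    then have "a \<le> (\<Sum>i=1..Suc n. g i)"
      using Suc.prems by (auto simp: le_Suc_eq)
    moreover have "stopped_exp l a (Suc n) g = exp (l * (\<Sum>i=1..Suc n. g i))"
      using False by (intro stopped_exp_before_hit) (metis less_Suc_eq_le not_le)
    ultimately show ?thesis
      using assms(1) by (simp only: exp_le_cancel_iff mult_left_mono)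
  qed
qed

text \<open>Lets the sequence be cut down to the indices \<open>1..n\<close>, as independence of
  blocks of variables requires.\<close>

lemma stopped_exp_cong:
  assumes "\<And>i. i \<in> {1..n} \<Longrightarrow> g i = h i"
  shows "stopped_exp l a n g = stopped_exp l a n h"
  using assms
proof (induction n)
  case (Suc n)
  then have "(\<Sum>i=1..k. g i) = (\<Sum>i=1..k. h i)" if "k \<le> n" for k
    using that by (intro sum.cong) auto
  then have "(\<exists>k\<le>n. a \<le> (\<Sum>i=1..k. g i)) = (\<exists>k\<le>n. a \<le> (\<Sum>i=1..k. h i))"
    by metis
  moreover have "stopped_exp l a n g = stopped_exp l a n h" "g (Suc n) = h (Suc n)"
    using Suc by auto
  ultimately show ?case
    unfolding stopped_exp.simps by (simp only:)
qed simp

lemma measurable_partial_sum_hit: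
  fixes f :: "nat \<Rightarrow> 'b \<Rightarrow> real"
  assumes "\<And>i. 1 \<le> i \<Longrightarrow> i \<le> n \<Longrightarrow> f i \<in> borel_measurable N"
  shows "Measurable.pred N (\<lambda>x. \<exists>k\<le>n. a \<le> (\<Sum>i=1..k. f i x))"
proof -
  have "Measurable.pred N (\<lambda>x. \<exists>k\<in>{..n}. a \<le> (\<Sum>i=1..k. f i x))"
  proof (rule pred_intros_finite(4))
    fix k assume "k \<in> {..n}"
    then have [measurable]: "(\<lambda>x. \<Sum>i=1..k. f i x) \<in> borel_measurable N"
      by (auto intro!: borel_measurable_sum assms)
    show "Measurable.pred N (\<lambda>x. a \<le> (\<Sum>i=1..k. f i x))"
      by measurable
  qed simp
  then show ?thesis unfolding Bex_def atMost_iff .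
qed

lemma measurable_hit_PiM:
  assumes "{1..n} \<subseteq> I"
  shows "Measurable.pred (PiM I (\<lambda>_. borel :: real measure)) (\<lambda>g. \<exists>k\<le>n. a \<le> (\<Sum>i=1..k::nat. g i))"
proof (rule measurable_partial_sum_hit[where f="\<lambda>i g. g i"])
  fix i assume "1 \<le> i" "i \<le> n"
  then have "i \<in> I" using assms by auto
  then show "(\<lambda>g. g i) \<in> borel_measurable (PiM I (\<lambda>_. borel :: real measure))"
    by (rule measurable_component_singleton)
qed

lemma measurable_stopped_exp_PiM:
  assumes "{1..n} \<subseteq> I"
  shows "stopped_exp l a n \<in> borel_measurable (PiM I (\<lambda>_. borel))"
  using assms
proof (induction n)
  case (Suc n)
  have sub: "{1..n} \<subseteq> I" "Suc n \<in> I" using Suc.prems by auto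
  have eq: "stopped_exp l a (Suc n) = (\<lambda>g. if \<exists>k\<le>n. a \<le> (\<Sum>i=1..k. g i) then stopped_exp l a n g
      else stopped_exp l a n g * exp (l * g (Suc n)))"
    by (rule ext) (rule stopped_exp.simps)
  note [measurable] = Suc.IH[OF sub(1)]
    measurable_component_singleton[OF sub(2), of "\<lambda>_. borel :: real measure"]
  show ?case unfolding eq
    by (rule measurable_If[OF _ _ measurable_hit_PiM[OF sub(1), unfolded pred_def]]) measurable
qed (simp add: stopped_exp.simps(1)[abs_def])

text \<open>Each step multiplies the mean by at most \<open>m\<close>: where no hit has occurred the
  new factor is independent of the past, and where one has occurred nothing changes, which
  \<open>1 \<le> m\<close> accommodates.\<close>

lemma (in prob_space) nn_integral_stopped_exp_le:
  fixes Y :: "nat \<Rightarrow> 'a \<Rightarrow> real"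
  assumes indep: "indep_vars (\<lambda>_. borel) Y {1..}"
    and m: "1 \<le> m" "\<And>i. 1 \<le> i \<Longrightarrow> (\<integral>\<^sup>+\<omega>. ennreal (exp (l * Y i \<omega>)) \<partial>M) \<le> m"
  shows "(\<integral>\<^sup>+\<omega>. ennreal (stopped_exp l a n (\<lambda>i. Y i \<omega>)) \<partial>M) \<le> m ^ n"
proof (induction n)
  case 0
  then show ?case by (simp add: emeasure_space_1)
next
  case (Suc n)
  define hit where "hit g \<longleftrightarrow> (\<exists>k\<le>n. a \<le> (\<Sum>i=1..k. g i))" for g :: "nat \<Rightarrow> real"
  define F where "F g = (if hit g then 0 else ennreal (stopped_exp l a n g))" for g
  define G where "G g = (if hit g then ennreal (stopped_exp l a n g) else 0)" for g
  have rv: "random_variable borel (Y i)" if "1 \<le> i" for i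
    using indep that by (auto simp: indep_vars_def)
  let ?P = "PiM {1..n} (\<lambda>_. borel) :: (nat \<Rightarrow> real) measure"
  have hit: "{g \<in> space ?P. hit g} \<in> sets ?P"
    unfolding hit_def by (rule measurable_hit_PiM[unfolded pred_def]) (rule order_refl)
  have exp: "(\<lambda>g. ennreal (stopped_exp l a n g)) \<in> borel_measurable ?P"
    by (rule measurable_compose[OF measurable_stopped_exp_PiM measurable_ennreal]) (rule order_refl)
  have FG: "F \<in> borel_measurable ?P" "G \<in> borel_measurable ?P"
    unfolding F_def[abs_def] G_def[abs_def]
    by (rule measurable_If[OF measurable_const exp hit] measurable_If[OF exp measurable_const hit], simp)+
  \<comment> \<open>Both functions see only the indices up to \<open>n\<close>, so they factor
    through the restricted family, which is independent of the variable with index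
    \<open>Suc n\<close>.\<close>
  have restr: "F (restrict (\<lambda>i. Y i \<omega>) {1..n}) = F (\<lambda>i. Y i \<omega>)"
       "G (restrict (\<lambda>i. Y i \<omega>) {1..n}) = G (\<lambda>i. Y i \<omega>)" for \<omega>
  proof -
    have "stopped_exp l a n (restrict (\<lambda>i. Y i \<omega>) {1..n}) = stopped_exp l a n (\<lambda>i. Y i \<omega>)"
      by (rule stopped_exp_cong) auto
    moreover have "hit (restrict (\<lambda>i. Y i \<omega>) {1..n}) = hit (\<lambda>i. Y i \<omega>)"
      unfolding hit_def by (intro ex_cong1 conj_cong refl arg_cong2[of _ _ _ _ "(\<le>)"] sum.cong) auto
    ultimately show "F (restrict (\<lambda>i. Y i \<omega>) {1..n}) = F (\<lambda>i. Y i \<omega>)"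
       "G (restrict (\<lambda>i. Y i \<omega>) {1..n}) = G (\<lambda>i. Y i \<omega>)"
      by (auto simp: F_def G_def)
  qed
  have restr_meas: "(\<lambda>\<omega>. restrict (\<lambda>i. Y i \<omega>) {1..n}) \<in> measurable M ?P"
    by (intro measurable_restrict rv) auto
  have meas: "(\<lambda>\<omega>. F (\<lambda>i. Y i \<omega>)) \<in> borel_measurable M" "(\<lambda>\<omega>. G (\<lambda>i. Y i \<omega>)) \<in> borel_measurable M"
    using measurable_compose[OF restr_meas FG(1)] measurable_compose[OF restr_meas FG(2)]
    unfolding restr .
  have "indep_var borel (F \<circ> (\<lambda>\<omega>. restrict (\<lambda>i. Y i \<omega>) {1..n}))
          borel ((\<lambda>f. ennreal (exp (l * f (Suc n)))) \<circ> (\<lambda>\<omega>. restrict (\<lambda>i. Y i \<omega>) {Suc n}))"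
    by (intro indep_var_compose[OF indep_var_restrict[OF indep]] FG) auto
  then have ind: "indep_var borel (\<lambda>\<omega>. F (\<lambda>i. Y i \<omega>)) borel (\<lambda>\<omega>. ennreal (exp (l * Y (Suc n) \<omega>)))"
    unfolding comp_def restr by simp
  have split: "ennreal (stopped_exp l a n g) = G g + F g" for g
    by (auto simp: F_def G_def)
  have "(\<integral>\<^sup>+\<omega>. ennreal (stopped_exp l a (Suc n) (\<lambda>i. Y i \<omega>)) \<partial>M)
      = (\<integral>\<^sup>+\<omega>. G (\<lambda>i. Y i \<omega>) + F (\<lambda>i. Y i \<omega>) * ennreal (exp (l * Y (Suc n) \<omega>)) \<partial>M)"
    unfolding stopped_exp.simps hit_def[symmetric]
    by (intro nn_integral_cong) (simp add: F_def G_def ennreal_mult stopped_exp_nonneg)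
  also have "\<dots> = (\<integral>\<^sup>+\<omega>. G (\<lambda>i. Y i \<omega>) \<partial>M)
      + (\<integral>\<^sup>+\<omega>. F (\<lambda>i. Y i \<omega>) * ennreal (exp (l * Y (Suc n) \<omega>)) \<partial>M)"
    using meas rv[of "Suc n"] by (intro nn_integral_add) auto
  also have "(\<integral>\<^sup>+\<omega>. F (\<lambda>i. Y i \<omega>) * ennreal (exp (l * Y (Suc n) \<omega>)) \<partial>M)
     = (\<integral>\<^sup>+\<omega>. F (\<lambda>i. Y i \<omega>) \<partial>M) * (\<integral>\<^sup>+\<omega>. ennreal (exp (l * Y (Suc n) \<omega>)) \<partial>M)"
    by (rule nn_integral_indep_mult[OF ind])
  also have "(\<integral>\<^sup>+\<omega>. G (\<lambda>i. Y i \<omega>) \<partial>M) + \<dots>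
     \<le> m * (\<integral>\<^sup>+\<omega>. G (\<lambda>i. Y i \<omega>) \<partial>M) + (\<integral>\<^sup>+\<omega>. F (\<lambda>i. Y i \<omega>) \<partial>M) * m"
  proof (rule add_mono)
    show "(\<integral>\<^sup>+\<omega>. G (\<lambda>i. Y i \<omega>) \<partial>M) \<le> m * (\<integral>\<^sup>+\<omega>. G (\<lambda>i. Y i \<omega>) \<partial>M)"
      using mult_right_mono[OF m(1), of "\<integral>\<^sup>+\<omega>. G (\<lambda>i. Y i \<omega>) \<partial>M"] by simp
    show "(\<integral>\<^sup>+\<omega>. F (\<lambda>i. Y i \<omega>) \<partial>M) * (\<integral>\<^sup>+\<omega>. ennreal (exp (l * Y (Suc n) \<omega>)) \<partial>M)
        \<le> (\<integral>\<^sup>+\<omega>. F (\<lambda>i. Y i \<omega>) \<partial>M) * m"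
      by (rule mult_left_mono[OF m(2)]) simp_all
  qed
  also have "\<dots> = m * (\<integral>\<^sup>+\<omega>. G (\<lambda>i. Y i \<omega>) + F (\<lambda>i. Y i \<omega>) \<partial>M)"
    using meas by (simp add: nn_integral_add distrib_left mult.commute)
  also have "\<dots> \<le> m * m ^ n"
    unfolding split[symmetric] by (rule mult_left_mono[OF Suc.IH]) simp
  finally show ?case by simp
qed

text \<open>Markov's inequality for the stopped exponential at time \<open>n\<close>, which is at
  least \<open>exp (l * a)\<close> as soon as some partial sum up to \<open>n\<close> has reached
  \<open>a\<close>.\<close>

lemma (in prob_space) prob_partial_sum_hit_le:
  fixes Y :: "nat \<Rightarrow> 'a \<Rightarrow> real"
  assumes indep: "indep_vars (\<lambda>_. borel) Y {1..}" and l: "0 \<le> l" "1 \<le> m"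
    and m: "\<And>i. 1 \<le> i \<Longrightarrow> (\<integral>\<^sup>+\<omega>. ennreal (exp (l * Y i \<omega>)) \<partial>M) \<le> ennreal m"
  shows "prob {\<omega>\<in>space M. \<exists>k\<le>n. a \<le> (\<Sum>i=1..k. Y i \<omega>)} \<le> m ^ n * exp (- (l * a))"
proof -
  define A where "A = {\<omega>\<in>space M. \<exists>k\<le>n. a \<le> (\<Sum>i=1..k. Y i \<omega>)}"
  have rv: "random_variable borel (Y i)" if "1 \<le> i" for i
    using indep that by (auto simp: indep_vars_def)
  have A [measurable]: "A \<in> sets M"
    unfolding A_def by (rule measurable_partial_sum_hit[of n Y M a, unfolded pred_def]) (rule rv)
  have "ennreal (exp (l * a)) * emeasure M A = (\<integral>\<^sup>+\<omega>. ennreal (exp (l * a)) * indicator A \<omega> \<partial>M)"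
    by (simp add: nn_integral_cmult_indicator)
  also have "\<dots> \<le> (\<integral>\<^sup>+\<omega>. ennreal (stopped_exp l a n (\<lambda>i. Y i \<omega>)) \<partial>M)"
  proof (intro nn_integral_mono)
    fix \<omega>
    have "ennreal (exp (l * a)) \<le> ennreal (stopped_exp l a n (\<lambda>i. Y i \<omega>))" if "\<omega> \<in> A"
      using that by (intro ennreal_leI stopped_exp_after_hit l(1)) (auto simp: A_def)
    then show "ennreal (exp (l * a)) * indicator A \<omega> \<le> ennreal (stopped_exp l a n (\<lambda>i. Y i \<omega>))"
      by (cases "\<omega> \<in> A") simp_all
  qed
  also have "\<dots> \<le> ennreal m ^ n"
    using l(2) by (intro nn_integral_stopped_exp_le indep m) auto
  finally have "ennreal (exp (l * a) * prob A) \<le> ennreal (m ^ n)"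
    using l(2) by (simp add: emeasure_eq_measure ennreal_mult ennreal_power)
  then have "exp (l * a) * prob A \<le> m ^ n"
    using l(2) by (subst (asm) ennreal_le_iff) auto
  then have "prob A \<le> m ^ n * exp (- (l * a))"
    by (simp add: exp_minus field_simps)
  then show ?thesis unfolding A_def .
qed

section \<open>Moment generating functions near zero\<close>

lemma exp_le_quadratic:
  fixes x :: real
  shows "exp x \<le> 1 + x + x\<^sup>2 * exp \<bar>x\<bar>"
proof -
  obtain t where t: "\<bar>t\<bar> \<le> \<bar>x\<bar>" "exp x = (\<Sum>m<2. x ^ m / fact m) + exp t / fact 2 * x ^ 2"
    using Maclaurin_exp_le[of x 2] by blast
  have "exp t / fact 2 * x\<^sup>2 \<le> exp \<bar>x\<bar> * x\<^sup>2"
  proof (rule mult_right_mono)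
    have "exp t / fact 2 \<le> exp t" by (simp add: fact_2)
    also have "\<dots> \<le> exp \<bar>x\<bar>" using t(1) by simp
    finally show "exp t / fact 2 \<le> exp \<bar>x\<bar>" .
  qed simp
  with t(2) show ?thesis
    by (simp add: numeral_2_eq_2 mult.commute)
qed

text \<open>With \<open>u = t * \<bar>y\<bar> / 2\<close> the exponential factor of the remainder is
  at most \<open>exp u\<close>, since \<open>l \<le> t / 2\<close>, and
  \<open>u\<^sup>2 / 2 \<le> exp u\<close> absorbs the square. The constant comes from \<open>(l *
  y)\<^sup>2 = 8 / t\<^sup>2 * l\<^sup>2 * (u\<^sup>2 / 2)\<close>.\<close>

lemma exp_le_quadratic_scaled:
  fixes l t y :: real
  assumes "0 < t" "0 \<le> l" "l \<le> t / 2"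
  shows "exp (l * y) \<le> 1 + l * y + 8 / t\<^sup>2 * l\<^sup>2 * exp (t * \<bar>y\<bar>)"
proof -
  define u where "u = t * \<bar>y\<bar> / 2"
  have u: "0 \<le> u" using assms by (simp add: u_def)
  have "\<bar>l * y\<bar> \<le> u"
    using assms mult_right_mono[of l "t / 2" "\<bar>y\<bar>"] by (simp add: u_def abs_mult)
  then have "exp \<bar>l * y\<bar> \<le> exp u" by simp
  moreover have "u\<^sup>2 / 2 \<le> exp u"
    using exp_lower_Taylor_quadratic[OF u] u by simp
  ultimately have "u\<^sup>2 / 2 * exp \<bar>l * y\<bar> \<le> exp u * exp u"
    by (intro mult_mono) auto
  also have "exp u * exp u = exp (t * \<bar>y\<bar>)"
    by (simp add: u_def exp_add[symmetric])
  finally have "8 / t\<^sup>2 * l\<^sup>2 * (u\<^sup>2 / 2 * exp \<bar>l * y\<bar>) \<le> 8 / t\<^sup>2 * l\<^sup>2 * exp (t * \<bar>y\<bar>)"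
    by (intro mult_left_mono) auto
  moreover have "8 / t\<^sup>2 * l\<^sup>2 * (u\<^sup>2 / 2 * exp \<bar>l * y\<bar>) = (l * y)\<^sup>2 * exp \<bar>l * y\<bar>"
    using assms(1) by (simp add: u_def power_mult_distrib power_divide field_simps)
  ultimately show ?thesis
    using exp_le_quadratic[of "l * y"] by linarith
qed

lemma (in prob_space) integrable_of_integrable_exp_abs:
  fixes Y :: "'a \<Rightarrow> real"
  assumes "random_variable borel Y" "0 < t" "integrable M (\<lambda>\<omega>. exp (t * \<bar>Y \<omega>\<bar>))"
  shows "integrable M Y"
proof (rule Bochner_Integration.integrable_bound)
  show "integrable M (\<lambda>\<omega>. exp (t * \<bar>Y \<omega>\<bar>) / t)" using assms by simp
  have "\<bar>Y \<omega>\<bar> \<le> exp (t * \<bar>Y \<omega>\<bar>) / t" for \<omega>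
  proof -
    have "\<bar>Y \<omega>\<bar> * t \<le> exp (t * \<bar>Y \<omega>\<bar>)"
      using exp_ge_add_one_self[of "t * \<bar>Y \<omega>\<bar>"] mult.commute[of "\<bar>Y \<omega>\<bar>" t] by linarith
    then show ?thesis using assms(2) by (simp only: pos_le_divide_eq)
  qed
  then show "AE \<omega> in M. norm (Y \<omega>) \<le> norm (exp (t * \<bar>Y \<omega>\<bar>) / t)"
    using assms(2) by simp
qed fact

text \<open>Integrating the quadratic bound removes the linear term, as the mean is zero; then
  \<open>1 + z \<le> exp z\<close>.\<close>

lemma (in prob_space) mgf_le_exp_square:
  fixes Y :: "'a \<Rightarrow> real"
  assumes Y: "random_variable borel Y" "expectation Y = 0"
    and t: "0 < t" "integrable M (\<lambda>\<omega>. exp (t * \<bar>Y \<omega>\<bar>))" "expectation (\<lambda>\<omega>. exp (t * \<bar>Y \<omega>\<bar>)) \<le> K"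
    and l: "0 \<le> l" "l \<le> t / 2"
  shows "(\<integral>\<^sup>+\<omega>. ennreal (exp (l * Y \<omega>)) \<partial>M) \<le> ennreal (exp (8 * K / t\<^sup>2 * l\<^sup>2))"
proof -
  let ?b = "\<lambda>\<omega>. 1 + l * Y \<omega> + 8 / t\<^sup>2 * l\<^sup>2 * exp (t * \<bar>Y \<omega>\<bar>)"
  note bound = exp_le_quadratic_scaled[OF t(1) l]
  have nonneg: "0 \<le> ?b \<omega>" for \<omega>
    using bound[of "Y \<omega>"] exp_gt_zero[of "l * Y \<omega>"] by linarith
  have int_Y: "integrable M Y"
    by (rule integrable_of_integrable_exp_abs[OF Y(1) t(1,2)])
  have int: "integrable M ?b"
    using int_Y t(2) by (intro Bochner_Integration.integrable_add) auto
  have "(\<integral>\<^sup>+\<omega>. ennreal (exp (l * Y \<omega>)) \<partial>M) \<le> (\<integral>\<^sup>+\<omega>. ennreal (?b \<omega>) \<partial>M)"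
    by (intro nn_integral_mono ennreal_leI bound)
  also have "\<dots> = ennreal (expectation ?b)"
    by (intro nn_integral_eq_integral int AE_I2 nonneg)
  also have "expectation ?b = 1 + 8 / t\<^sup>2 * l\<^sup>2 * expectation (\<lambda>\<omega>. exp (t * \<bar>Y \<omega>\<bar>))"
    using int_Y t(2) Y(2) by (simp add: prob_space)
  also have "\<dots> \<le> 1 + 8 / t\<^sup>2 * l\<^sup>2 * K"
    using t by (intro add_left_mono mult_left_mono) auto
  also have "\<dots> = 1 + 8 * K / t\<^sup>2 * l\<^sup>2" by simp
  also have "\<dots> \<le> exp (8 * K / t\<^sup>2 * l\<^sup>2)"
    by (rule exp_ge_add_one_self)
  finally show ?thesis by (simp add: ennreal_leI)
qed

section \<open>Dyadic blocks and the Borel-Cantelli lemma\<close>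

text \<open>For large \<open>k\<close> the partial sums up to \<open>2 ^ k\<close> reach
  \<open>a k\<close> with probability at most \<open>1 / k\<^sup>2\<close>, so almost surely this
  happens for finitely many \<open>k\<close> only. An \<open>n\<close> with
  \<open>2 ^ k \<le> n < 2 ^ (k + 1)\<close> is covered by the block \<open>k + 1\<close>, whose
  level is at most of order \<open>n * lil_rate n\<close>.\<close>

lemma (in prob_space) lil_upper_one_sided:
  fixes Y :: "nat \<Rightarrow> 'a \<Rightarrow> real"
  assumes indep: "indep_vars (\<lambda>_. borel) Y {1..}" and c: "0 \<le> c" "0 < l0"
    and mgf: "\<And>i l. 1 \<le> i \<Longrightarrow> 0 \<le> l \<Longrightarrow> l \<le> l0 \<Longrightarrow>
      (\<integral>\<^sup>+\<omega>. ennreal (exp (l * Y i \<omega>)) \<partial>M) \<le> ennreal (exp (c * l\<^sup>2))"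
  shows "AE \<omega> in M. \<forall>\<^sub>F n in sequentially. (\<Sum>i=1..n. Y i \<omega>) \<le> 2 * (c + 2) * (real n * lil_rate n)"
proof -
  \<comment> \<open>Chosen so that \<open>2 ^ k * (l k)\<^sup>2 = ln k\<close> and
    \<open>l k * a k = (c + 2) * ln k\<close>: the exponent \<open>c * ln k - (c + 2) * ln k\<close>
    is then \<open>- 2 * ln k\<close>, which is summable after exponentiation.\<close>
  define l a where "l k = sqrt (ln (real k) / 2 ^ k)" and "a k = (c + 2) * sqrt (2 ^ k * ln (real k))" for k :: nat
  define A where "A k = {\<omega>\<in>space M. \<exists>j\<le>2 ^ k. a k \<le> (\<Sum>i=1..j. Y i \<omega>)}" for k
  have rv: "random_variable borel (Y i)" if "1 \<le> i" for i
    using indep that by (auto simp: indep_vars_def)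
  have A: "A k \<in> events" for k
    unfolding A_def by (rule measurable_partial_sum_hit[unfolded pred_def]) (rule rv)
  have "l \<longlonglongrightarrow> 0"
    unfolding l_def by real_asymp
  then have "\<forall>\<^sub>F k in sequentially. l k < l0"
    using c(2) by (rule order_tendstoD)
  then have "\<forall>\<^sub>F k in sequentially. prob (A k) \<le> inverse (real k ^ 2)"
    using eventually_ge_at_top[of "1::nat"]
  proof eventually_elim
    case (elim k)
    have lnk: "0 \<le> ln (real k)" using elim by simp
    have l0: "0 \<le> l k" using lnk by (simp add: l_def)
    have l_sq: "2 ^ k * (l k)\<^sup>2 = ln (real k)"
      using lnk by (simp add: l_def)
    have l_a: "l k * a k = (c + 2) * ln (real k)"
      using lnk by (simp add: l_def a_def real_sqrt_mult[symmetric] power2_eq_square[symmetric])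
    have "prob (A k) \<le> exp (c * (l k)\<^sup>2) ^ (2 ^ k) * exp (- (l k * a k))"
      unfolding A_def using elim l0 c(1) by (intro prob_partial_sum_hit_le indep mgf) auto
    also have "\<dots> = exp (c * (2 ^ k * (l k)\<^sup>2) - l k * a k)"
      by (simp add: exp_of_nat_mult[symmetric] exp_add[symmetric] mult_ac)
    also have "\<dots> = exp (- (2 * ln (real k)))"
      unfolding l_sq l_a by (simp add: algebra_simps)
    also have "\<dots> = inverse (real k ^ 2)"
      using elim by (simp add: exp_minus exp_double)
    finally show ?case .
  qed
  then have "summable (\<lambda>k. prob (A k))"
    by (intro summable_comparison_test_ev[OF _ inverse_power_summable[of 2]]) auto
  then have "AE \<omega> in M. \<forall>\<^sub>F k in sequentially. \<omega> \<in> space M - A k"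
    by (intro borel_cantelli_AE1 A) (auto simp: emeasure_eq_measure)
  then show ?thesis
  proof eventually_elim
    case (elim \<omega>)
    then obtain K where K: "\<And>k. K \<le> k \<Longrightarrow> \<omega> \<in> space M - A k"
      by (auto simp: eventually_sequentially)
    \<comment> \<open>As \<open>k\<close> is at most \<open>ln n / ln 2\<close>, this yields
      \<open>ln (k + 1) \<le> 2 * ln (ln n)\<close> below.\<close>
    have "\<forall>\<^sub>F n in sequentially. ln (real n) / ln 2 + 1 \<le> (ln (real n))\<^sup>2"
      by real_asymp
    then show ?case
      \<comment> \<open>Since \<open>exp 1 \<le> 3\<close>, the bound 3 makes
        \<open>ln (ln n)\<close> nonnegative; the bound \<open>2 ^ K\<close> places the block
        \<open>k + 1\<close> among those that miss their level.\<close>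
      using eventually_ge_at_top[of "max 3 (2 ^ K)"]
    proof eventually_elim
      case (elim n)
      have "n \<ge> 1" using elim by simp
      then obtain k where k: "2 ^ k \<le> n" "n < 2 ^ (k + 1)"
        using ex_power_ivl1[of 2 n] by auto
      have "(2::nat) ^ K < 2 ^ (k + 1)" using elim k by linarith
      then have "K \<le> k + 1" using power_less_imp_less_exp[of "2::nat" K "k + 1"] by simp
      then have "\<omega> \<in> space M - A (k + 1)" by (rule K)
      moreover have "n \<le> 2 ^ (k + 1)" using k by simp
      ultimately have "\<not> a (k + 1) \<le> (\<Sum>i=1..n. Y i \<omega>)"
        unfolding A_def by blast
      then have sum_less: "(\<Sum>i=1..n. Y i \<omega>) < a (k + 1)"
        by (simp only: not_le)
      have "real (2 ^ k) \<le> real n" using k(1) by (rule of_nat_mono)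
      then have "ln (2 ^ k) \<le> ln (real n)"
        using \<open>n \<ge> 1\<close> by (subst ln_le_cancel_iff) auto
      then have "real k * ln 2 \<le> ln (real n)" by (simp add: ln_realpow)
      then have "real k \<le> ln (real n) / ln 2" by (simp add: field_simps)
      then have "real (k + 1) \<le> (ln (real n))\<^sup>2" using elim by simp
      then have "ln (real (k + 1)) \<le> ln ((ln (real n))\<^sup>2)"
        by (rule ln_mono) simp
      also have "\<dots> = 2 * ln (ln (real n))" using elim by (simp add: ln_realpow)
      finally have ln_k: "ln (real (k + 1)) \<le> 2 * ln (ln (real n))" .
      have ln_n: "0 \<le> ln (ln (real n))"
      proof -
        have "exp 1 \<le> real n" using elim exp_le by linarith
        then have "1 \<le> ln (real n)" using elim by (subst ln_ge_iff) auto
        then show ?thesis by simp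
      qed
      have "(2::real) ^ (k + 1) \<le> 2 * real n" using \<open>real (2 ^ k) \<le> real n\<close> by simp
      then have "2 ^ (k + 1) * ln (real (k + 1)) \<le> 2 * real n * (2 * ln (ln (real n)))"
        using ln_k by (intro mult_mono) auto
      then have "sqrt (2 ^ (k + 1) * ln (real (k + 1))) \<le> sqrt (2 * real n * (2 * ln (ln (real n))))"
        by simp
      \<comment> \<open>Pulling \<open>(2 * n)\<^sup>2\<close> out of the root leaves exactly the
        square of the rate.\<close>
      also have "2 * real n * (2 * ln (ln (real n))) = (2 * real n)\<^sup>2 * (ln (ln (real n)) / real n)"
        using elim by (simp add: power2_eq_square field_simps)
      also have "sqrt \<dots> = 2 * (real n * lil_rate n)"
        unfolding real_sqrt_mult[of "(2 * real n)\<^sup>2"] real_sqrt_abs lil_rate_def by simp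
      finally have "a (k + 1) \<le> (c + 2) * (2 * (real n * lil_rate n))"
        unfolding a_def using c by (intro mult_left_mono) auto
      also have "\<dots> = 2 * (c + 2) * (real n * lil_rate n)" by simp
      finally show ?case using sum_less by linarith
    qed
  qed
qed

text \<open>The one-sided bound for \<open>Y\<close> and for \<open>- Y\<close>, where the
  exponential moment controls the moment generating function up to \<open>t / 2\<close>.\<close>

lemma (in prob_space) lil_upper_bound:
  fixes Y :: "nat \<Rightarrow> 'a \<Rightarrow> real"
  assumes indep: "indep_vars (\<lambda>_. borel) Y {1..}" and t: "0 < t"
    and mean: "\<And>i. 1 \<le> i \<Longrightarrow> expectation (Y i) = 0"
    and moment: "\<And>i. 1 \<le> i \<Longrightarrow> integrable M (\<lambda>\<omega>. exp (t * \<bar>Y i \<omega>\<bar>))"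
      "\<And>i. 1 \<le> i \<Longrightarrow> expectation (\<lambda>\<omega>. exp (t * \<bar>Y i \<omega>\<bar>)) \<le> K"
  shows "AE \<omega> in M. (\<lambda>n. (1 / real n) * (\<Sum>i=1..n. Y i \<omega>)) \<in> O(lil_rate)"
proof -
  define C where "C = 2 * (8 * K / t\<^sup>2 + 2)"
  have rv: "random_variable borel (Y i)" if "1 \<le> i" for i
    using indep that by (auto simp: indep_vars_def)
  have "0 \<le> expectation (\<lambda>\<omega>. exp (t * \<bar>Y 1 \<omega>\<bar>))" by (intro integral_nonneg_AE) auto
  also have "\<dots> \<le> K" using moment(2)[of 1] by simp
  finally have K: "0 \<le> 8 * K / t\<^sup>2" by simp
  have "AE \<omega> in M. \<forall>\<^sub>F n in sequentially. (\<Sum>i=1..n. Y i \<omega>) \<le> C * (real n * lil_rate n)"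
    unfolding C_def
    by (rule lil_upper_one_sided[OF indep K half_gt_zero[OF t]])
       (intro mgf_le_exp_square rv mean t moment)
  moreover have "AE \<omega> in M. \<forall>\<^sub>F n in sequentially. (\<Sum>i=1..n. - Y i \<omega>) \<le> C * (real n * lil_rate n)"
    unfolding C_def
  proof (rule lil_upper_one_sided[OF _ K half_gt_zero[OF t]])
    show "indep_vars (\<lambda>_. borel) (\<lambda>i \<omega>. - Y i \<omega>) {1..}"
      by (rule indep_vars_compose2[OF indep]) simp
    show "(\<integral>\<^sup>+\<omega>. ennreal (exp (l * - Y i \<omega>)) \<partial>M) \<le> ennreal (exp (8 * K / t\<^sup>2 * l\<^sup>2))"
      if "1 \<le> i" "0 \<le> l" "l \<le> t / 2" for i l
      using that mean[of i] moment[of i] rv[of i] t by (intro mgf_le_exp_square) auto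
  qed
  ultimately show ?thesis
  proof eventually_elim
    case (elim \<omega>)
    have "\<forall>\<^sub>F n in sequentially. \<bar>(1 / real n) * (\<Sum>i=1..n. Y i \<omega>)\<bar> \<le> C * \<bar>lil_rate n\<bar>"
      using elim eventually_gt_at_top[of 0]
    proof eventually_elim
      case (elim n)
      then have "\<bar>\<Sum>i=1..n. Y i \<omega>\<bar> \<le> C * (real n * lil_rate n)"
        by (simp add: sum_negf)
      then have "\<bar>\<Sum>i=1..n. Y i \<omega>\<bar> / real n \<le> C * lil_rate n"
        using elim by (simp add: field_simps)
      also have "\<dots> \<le> C * \<bar>lil_rate n\<bar>"
        using K by (intro mult_left_mono) (auto simp: C_def)
      finally show ?case by (simp add: abs_mult)
    qed
    then show ?case
      by (intro bigoI[of _ C]) simp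
  qed
qed

section \<open>Positive definite matrices\<close>

text \<open>The quadratic form attains its minimum on the compact unit sphere; this minimum is
  positive, and homogeneity of degree two carries it to all vectors.\<close>

lemma pos_def_coercive:
  fixes A :: "real ^ 'n ^ 'n"
  assumes "\<And>x. x \<noteq> 0 \<Longrightarrow> 0 < x \<bullet> (A *v x)"
  obtains m where "0 < m" "\<And>x. m * (norm x)\<^sup>2 \<le> x \<bullet> (A *v x)"
proof -
  have "\<exists>x. x \<in> sphere (0 :: real ^ 'n) 1"
    using vector_choose_size[of 1] by auto
  moreover have "continuous_on (sphere 0 1) (\<lambda>x. x \<bullet> (A *v x))"
    by (intro continuous_on_inner continuous_on_id matrix_vector_mult_linear_continuous_on)
  ultimately have "\<exists>u\<in>sphere (0 :: real ^ 'n) 1. \<forall>x\<in>sphere 0 1. u \<bullet> (A *v u) \<le> x \<bullet> (A *v x)"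
    by (intro continuous_attains_inf compact_sphere) auto
  then obtain u where u: "norm u = 1" "\<And>x. norm x = 1 \<Longrightarrow> u \<bullet> (A *v u) \<le> x \<bullet> (A *v x)"
    by auto
  have "(u \<bullet> (A *v u)) * (norm x)\<^sup>2 \<le> x \<bullet> (A *v x)" for x
  proof (cases "x = 0")
    case False
    let ?v = "(1 / norm x) *\<^sub>R x"
    have "u \<bullet> (A *v u) \<le> ?v \<bullet> (A *v ?v)"
      using False by (intro u(2)) simp
    also have "\<dots> = (x \<bullet> (A *v x)) / (norm x)\<^sup>2"
      by (simp add: matrix_vector_mult_scaleR power2_eq_square)
    finally show ?thesis
      using False by (simp add: field_simps)
  qed simp
  moreover have "0 < u \<bullet> (A *v u)"
    using u(1) by (intro assms) auto
  ultimately show thesis using that by blast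
qed

lemma pos_def_invertible:
  fixes A :: "real ^ 'n ^ 'n"
  assumes "\<And>x. x \<noteq> 0 \<Longrightarrow> 0 < x \<bullet> (A *v x)"
  shows "invertible A"
  unfolding invertible_left_inverse matrix_left_invertible_ker
  using assms by (metis inner_zero_right less_irrefl)

lemma matrix_inv_invertible:
  fixes A :: "real ^ 'n ^ 'n"
  assumes "invertible A"
  shows "A ** matrix_inv A = mat 1" "matrix_inv A ** A = mat 1"
proof -
  have "A ** matrix_inv A = mat 1 \<and> matrix_inv A ** A = mat 1"
    using assms unfolding invertible_def matrix_inv_def by (rule someI_ex)
  then show "A ** matrix_inv A = mat 1" "matrix_inv A ** A = mat 1" by auto
qed

lemma matrix_inv_mult_vec:
  fixes A :: "real ^ 'n ^ 'n"
  assumes "invertible A"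
  shows "A *v (matrix_inv A *v x) = x" "matrix_inv A *v (A *v x) = x"
  using matrix_inv_invertible[OF assms] by (simp_all add: matrix_vector_mul_assoc)

lemma inner_symmetric_matrix:
  fixes A :: "real ^ 'n ^ 'n"
  assumes "transpose A = A"
  shows "x \<bullet> (A *v y) = (A *v x) \<bullet> y"
  by (metis assms dot_lmul_matrix transpose_matrix_vector)

lemma sym_pos_defD:
  assumes "sym_pos_def S"
  shows "transpose S = S" "x \<noteq> 0 \<Longrightarrow> 0 < x \<bullet> (S *v x)" "invertible S"
  using assms pos_def_invertible[of S] by (auto simp: sym_pos_def_def)

text \<open>Symmetry and positivity of \<open>S\<close>, read at vectors of the form
  \<open>matrix_inv S *v x\<close>.\<close>

lemma sym_pos_def_matrix_inv:
  assumes S: "sym_pos_def S"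
  shows "sym_pos_def (matrix_inv S)"
  unfolding sym_pos_def_def
proof (intro conjI allI impI)
  note inv = matrix_inv_mult_vec[OF sym_pos_defD(3)[OF S]]
  have sym: "x \<bullet> (matrix_inv S *v y) = (matrix_inv S *v x) \<bullet> y" for x y
    using inner_symmetric_matrix[OF sym_pos_defD(1)[OF S], of "matrix_inv S *v x" "matrix_inv S *v y"]
    by (simp add: inv)
  have "transpose (matrix_inv S) *v x = matrix_inv S *v x" for x
    by (rule vector_eq_ldot[THEN iffD1]) (metis dot_lmul_matrix inner_commute sym transpose_matrix_vector)
  then show "transpose (matrix_inv S) = matrix_inv S"
    by (simp add: matrix_eq)
  fix x :: "real ^ 'a" assume "x \<noteq> 0"
  then have "matrix_inv S *v x \<noteq> 0" using inv(1)[of x] by auto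
  then have "0 < (matrix_inv S *v x) \<bullet> (S *v (matrix_inv S *v x))"
    by (rule sym_pos_defD(2)[OF S])
  then show "0 < x \<bullet> (matrix_inv S *v x)"
    by (simp add: inv inner_commute)
qed

lemma inv_norm_power2:
  assumes "sym_pos_def S"
  shows "(inv_norm S y)\<^sup>2 = y \<bullet> (matrix_inv S *v y)"
  using sym_pos_defD(2)[OF sym_pos_def_matrix_inv[OF assms], of y]
  by (cases "y = 0") (auto simp: inv_norm_def)

lemma inv_norm_nonneg:
  assumes "sym_pos_def S"
  shows "0 \<le> inv_norm S y"
  using sym_pos_defD(2)[OF sym_pos_def_matrix_inv[OF assms], of y]
  by (cases "y = 0") (auto simp: inv_norm_def)

lemma inv_norm_scaleR: "inv_norm S (c *\<^sub>R y) = \<bar>c\<bar> * inv_norm S y"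
  by (simp add: inv_norm_def matrix_vector_mult_scaleR real_sqrt_mult mult.assoc[symmetric])

lemma inv_norm_minus: "inv_norm S (- y) = inv_norm S y"
  using inv_norm_scaleR[of S "-1" y] by simp

lemma continuous_on_inv_norm: "continuous_on UNIV (inv_norm S)"
  unfolding inv_norm_def
  by (intro continuous_on_real_sqrt continuous_on_inner continuous_on_id
      matrix_vector_mult_linear_continuous_on)

text \<open>The constant is the square root of a coercivity constant of the inverse matrix.\<close>

lemma inv_norm_lower_bound:
  assumes "sym_pos_def S"
  obtains m where "0 < m" "\<And>y. m * norm y \<le> inv_norm S y"
proof -
  obtain m where m: "0 < m" "\<And>y. m * (norm y)\<^sup>2 \<le> y \<bullet> (matrix_inv S *v y)"
    using pos_def_coercive[of "matrix_inv S"] sym_pos_defD(2)[OF sym_pos_def_matrix_inv[OF assms]]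
    by metis
  have "sqrt m * norm y \<le> inv_norm S y" for y
    using real_sqrt_le_mono[OF m(2)[of y]] by (simp add: inv_norm_def real_sqrt_mult)
  with m(1) show thesis by (intro that[of "sqrt m"]) auto
qed

section \<open>The centred ellipsoidal distribution\<close>

text \<open>By scaling, the set where \<open>N y \<le> r\<close> has volume
  \<open>V * r ^ DIM('a)\<close>, with \<open>V\<close> the volume of the unit set. Differentiation
  in \<open>r\<close> gives the density, so \<open>\<kappa>\<close> is the dimension times
  \<open>V\<close>.\<close>

lemma lborel_distr_homogeneous:
  fixes N :: "'a::euclidean_space \<Rightarrow> real"
  assumes cont: "continuous_on UNIV N"
    and hom: "\<And>c y. N (c *\<^sub>R y) = \<bar>c\<bar> * N y"
    and m: "0 < m" "\<And>y. m * norm y \<le> N y"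
  obtains \<kappa> where "0 \<le> \<kappa>"
    "distr lborel borel N = density lborel (\<lambda>r. ennreal (\<kappa> * r ^ (DIM('a) - 1)) * indicator {0..} r)"
proof -
  let ?d = "DIM('a)"
  define V where "V = measure lborel {y. N y \<le> 1}"
  define \<kappa> where "\<kappa> = real ?d * V"
  have V: "0 \<le> V" by (simp add: V_def)
  then have \<kappa>: "0 \<le> \<kappa>" by (simp add: \<kappa>_def)
  have meas [measurable]: "N \<in> borel_measurable borel"
    using cont by (rule borel_measurable_continuous_onI)
  have N_nonneg: "0 \<le> N y" for y
    using m(2)[of y] m(1) by (meson mult_nonneg_nonneg norm_ge_zero less_imp_le order_trans)
  \<comment> \<open>The lower bound on \<open>N\<close> encloses the unit set in a ball, so that
    \<open>V\<close> is finite.\<close>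
  have "{y. N y \<le> 1} \<subseteq> cball 0 (1 / m)"
  proof safe
    fix y assume "N y \<le> 1"
    then have "m * norm y \<le> 1" using m(2)[of y] by linarith
    then show "y \<in> cball 0 (1 / m)" using m(1) by (simp add: field_simps)
  qed
  then have "emeasure lborel {y. N y \<le> 1} \<le> emeasure lborel (cball 0 (1 / m) :: 'a set)"
    by (intro emeasure_mono) auto
  also have "\<dots> < \<infinity>"
    by (rule emeasure_bounded_finite) (rule bounded_cball)
  finally have unit: "emeasure lborel {y. N y \<le> 1} = ennreal V"
    unfolding V_def by (intro emeasure_eq_ennreal_measure) auto
  have lhs: "emeasure (distr lborel borel N) {..r} = ennreal (V * r ^ ?d)" if "0 \<le> r" for r
  proof (cases "r = 0")
    \<comment> \<open>Scaling by zero is degenerate; here the set shrinks to the origin, which is a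
      null set.\<close>
    case True
    have "y = 0" if "N y \<le> 0" for y
    proof -
      have "m * norm y \<le> 0" using m(2)[of y] that by linarith
      then show ?thesis using m(1) by (simp add: mult_le_0_iff)
    qed
    then have "N -` {..0} \<subseteq> {0}" by auto
    then have "emeasure lborel (N -` {..0}) \<le> emeasure lborel {0 :: 'a}"
      by (intro emeasure_mono) auto
    then show ?thesis using True by (simp add: emeasure_distr power_0_left)
  next
    case False
    then have r: "0 < r" using that by simp
    have "emeasure (distr lborel borel N) {..r} = emeasure lborel (N -` {..r})"
      by (simp add: emeasure_distr)
    also have "\<dots> = emeasure (density (distr lborel borel (\<lambda>x :: 'a. 0 + r *\<^sub>R x)) (\<lambda>_. \<bar>r\<bar> ^ ?d)) (N -` {..r})"
      using lborel_affine[of r "0 :: 'a"] r by simp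
    also have "\<dots> = ennreal (r ^ ?d) * emeasure lborel ((\<lambda>x. r *\<^sub>R x) -` (N -` {..r}))"
    proof -
      have "N -` {..r} \<in> sets borel" using measurable_sets[OF meas, of "{..r}"] by simp
      then show ?thesis
        using r by (simp add: emeasure_density nn_integral_cmult_indicator emeasure_distr ennreal_power)
    qed
    also have "(\<lambda>x. r *\<^sub>R x) -` (N -` {..r}) = {y. N y \<le> 1}"
      using r by (auto simp: hom)
    finally show ?thesis
      using r V by (simp add: unit ennreal_mult[symmetric] mult.commute)
  qed
  have rhs: "emeasure (density lborel (\<lambda>r. ennreal (\<kappa> * r ^ (?d - 1)) * indicator {0..} r)) {..r}
      = ennreal (V * r ^ ?d)" if "0 \<le> r" for r
  proof -
    have "emeasure (density lborel (\<lambda>r. ennreal (\<kappa> * r ^ (?d - 1)) * indicator {0..} r)) {..r}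
      = (\<integral>\<^sup>+x. ennreal (\<kappa> * x ^ (?d - 1)) * indicator {0..r} x \<partial>lborel)"
      by (subst emeasure_density) (auto intro!: nn_integral_cong simp: indicator_def)
    also have "\<dots> = ennreal (V * r ^ ?d - V * 0 ^ ?d)"
    proof (rule nn_integral_FTC_Icc)
      fix x :: real assume "x \<in> {0..r}"
      show "((\<lambda>x. V * x ^ ?d) has_real_derivative \<kappa> * x ^ (?d - 1)) (at x)"
        unfolding \<kappa>_def by (auto intro!: derivative_eq_intros)
      show "0 \<le> \<kappa> * x ^ (?d - 1)" using \<kappa> \<open>x \<in> {0..r}\<close> by simp
    qed (use that in simp_all)
    finally show ?thesis by (simp add: power_0_left)
  qed
  \<comment> \<open>Half-lines are stable under intersection and generate the Borel sets, and those
    ending at natural numbers cover the line with finite measure each.\<close>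
  have "distr lborel borel N = density lborel (\<lambda>r. ennreal (\<kappa> * r ^ (?d - 1)) * indicator {0..} r)"
  proof (rule measure_eqI_generator_eq[where \<Omega>=UNIV and E="range (\<lambda>r::real. {..r})" and A="\<lambda>i. {..real i}"])
    show "Int_stable (range (\<lambda>r::real. {..r}))"
      by (auto simp: Int_stable_def)
    show "emeasure (distr lborel borel N) X
      = emeasure (density lborel (\<lambda>r. ennreal (\<kappa> * r ^ (?d - 1)) * indicator {0..} r)) X"
      if range: "X \<in> range (\<lambda>r::real. {..r})" for X
    proof -
      obtain r where X: "X = {..r}" using range by auto
      show ?thesis
      proof (cases "0 \<le> r")
        case True
        show ?thesis unfolding X lhs[OF True] rhs[OF True] by (rule refl)
      next
        case False
        have "\<not> N y \<le> r" for y using N_nonneg[of y] False by linarith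
        then have "N -` {..r} = {}" by auto
        then have "emeasure (distr lborel borel N) X = 0"
          unfolding X by (simp add: emeasure_distr)
        moreover have "emeasure (density lborel (\<lambda>r. ennreal (\<kappa> * r ^ (?d - 1)) * indicator {0..} r)) X
          = (\<integral>\<^sup>+(x::real). 0 \<partial>lborel)"
          unfolding X using False
          by (subst emeasure_density, simp, simp, intro nn_integral_cong) (simp add: indicator_def)
        ultimately show ?thesis by simp
      qed
    qed
    have "sets (borel :: real measure) = sigma_sets UNIV (range (\<lambda>r::real. {..r}))"
      by (subst borel_eq_atMost) (rule sets_measure_of, simp)
    then show "sets (distr lborel borel N) = sigma_sets UNIV (range (\<lambda>r::real. {..r}))"
      "sets (density lborel (\<lambda>r. ennreal (\<kappa> * r ^ (?d - 1)) * indicator {0..} r)) = sigma_sets UNIV (range (\<lambda>r::real. {..r}))"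
      by (simp_all only: sets_distr sets_density sets_lborel)
    show "(\<Union>i. {..real i}) = UNIV"
      by (auto intro: real_arch_simple)
    show "emeasure (distr lborel borel N) {..real i} \<noteq> \<infinity>" for i
      by (simp add: lhs)
  qed auto
  with \<kappa> show thesis by (rule that)
qed

text \<open>The determinant of an involution squares to one, so the volumes of boxes are
  preserved.\<close>

lemma lborel_distr_linear_involution:
  fixes T :: "real ^ 'n::{finite,wellorder} \<Rightarrow> real ^ 'n::_"
  assumes lin: "linear T" and inv: "\<And>x. T (T x) = x"
  shows "distr lborel borel T = lborel"
proof (rule sym, rule lborel_eqI)
  have meas [measurable]: "T \<in> borel_measurable borel"
    using lin by (intro borel_measurable_continuous_onI linear_continuous_on) (simp add: linear_conv_bounded_linear)
  have "matrix T ** matrix T = mat 1"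
    using matrix_compose[OF lin lin] inv by (simp add: comp_def id_def[symmetric] matrix_id_mat_1)
  then have "det (matrix T) * det (matrix T) = 1"
    by (metis det_I det_mul)
  then have det: "\<bar>det (matrix T)\<bar> = 1"
    using abs_square_eq_1[of "det (matrix T)"] by (simp add: power2_eq_square)
  fix l u :: "real ^ 'n::_" assume le: "\<And>b. b \<in> Basis \<Longrightarrow> l \<bullet> b \<le> u \<bullet> b"
  \<comment> \<open>As \<open>T\<close> is its own inverse, the preimage is an image, and the volume
    formula with the determinant applies.\<close>
  have img: "T -` box l u = T ` box l u"
  proof (intro set_eqI iffI)
    fix x assume "x \<in> T -` box l u"
    then show "x \<in> T ` box l u" using inv[of x] by (metis image_eqI vimageE)
  qed (use inv in auto)
  have "emeasure (distr lborel borel T) (box l u) = emeasure lborel (T -` box l u)"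
    by (simp add: emeasure_distr)
  also have "\<dots> = emeasure lebesgue (T -` box l u)"
    using measurable_sets[OF meas, of "box l u"] by simp
  also have "\<dots> = ennreal (measure lebesgue (T ` box l u))"
    unfolding img by (intro emeasure_eq_measure2 measurable_linear_image lin lmeasurable_box)
  also have "measure lebesgue (T ` box l u) = measure lebesgue (box l u)"
    by (simp add: measure_linear_image lin det)
  also have "\<dots> = (\<Prod>b\<in>Basis. (u - l) \<bullet> b)"
    using le by (simp add: measure_lborel_box)
  finally show "emeasure (distr lborel borel T) (box l u) = (\<Prod>b\<in>Basis. (u - l) \<bullet> b)" .
qed simp

section \<open>The radial integrals \<open>J_int\<close>\<close>

text \<open>\<open>(t - 2)\<^sup>2 \<ge> 0\<close> gives
  \<open>(t - 1)\<^sup>2 \<ge> t\<^sup>2 / 2 - 1\<close>, hence a Gaussian bound with exponent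
  \<open>- t\<^sup>2 / (4 * \<sigma>\<^sup>2)\<close>; a weight with
  \<open>s \<le> 1 / (8 * \<sigma>\<^sup>2)\<close> uses up at most half of it.\<close>

lemma radial_weight_le:
  fixes \<sigma> t :: real
  assumes \<sigma>: "0 < \<sigma>" and s: "s \<le> 1 / (8 * \<sigma>\<^sup>2)"
  shows "exp (s * t\<^sup>2) * exp (- (t - 1)\<^sup>2 / (2 * \<sigma>\<^sup>2))
    \<le> exp (1 / (2 * \<sigma>\<^sup>2)) * exp (- t\<^sup>2 / (8 * \<sigma>\<^sup>2))"
proof -
  have "t\<^sup>2 / 2 - 1 \<le> (t - 1)\<^sup>2"
    using zero_le_power2[of "t - 2"] by (simp add: power2_eq_square algebra_simps)
  then have "- (t - 1)\<^sup>2 / (2 * \<sigma>\<^sup>2) \<le> (1 - t\<^sup>2 / 2) / (2 * \<sigma>\<^sup>2)"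
    by (intro divide_right_mono) auto
  also have "\<dots> = 1 / (2 * \<sigma>\<^sup>2) - t\<^sup>2 / (4 * \<sigma>\<^sup>2)"
    using \<sigma> by (simp add: field_simps)
  finally have "- (t - 1)\<^sup>2 / (2 * \<sigma>\<^sup>2) \<le> 1 / (2 * \<sigma>\<^sup>2) - t\<^sup>2 / (4 * \<sigma>\<^sup>2)" .
  moreover have "s * t\<^sup>2 \<le> t\<^sup>2 / (8 * \<sigma>\<^sup>2)"
    using mult_right_mono[OF s, of "t\<^sup>2"] by simp
  moreover have "t\<^sup>2 / (4 * \<sigma>\<^sup>2) = 2 * (t\<^sup>2 / (8 * \<sigma>\<^sup>2))" by simp
  ultimately have "s * t\<^sup>2 + (- (t - 1)\<^sup>2 / (2 * \<sigma>\<^sup>2)) \<le> 1 / (2 * \<sigma>\<^sup>2) + (- t\<^sup>2 / (8 * \<sigma>\<^sup>2))"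
    by (simp only: minus_divide_left[symmetric])
  then show ?thesis
    by (simp only: exp_add[symmetric] exp_le_cancel_iff)
qed

text \<open>Domination by an absolute moment of the normal law with standard deviation
  \<open>2 * \<sigma>\<close>, whose exponent is the half that the weight leaves.\<close>

lemma integrable_radial_weight:
  fixes \<sigma> :: real
  assumes \<sigma>: "0 < \<sigma>" and s: "s \<le> 1 / (8 * \<sigma>\<^sup>2)"
  shows "integrable lborel (\<lambda>t. indicator {0..} t * (t ^ q * exp (- (t - 1)\<^sup>2 / (2 * \<sigma>\<^sup>2))) * exp (s * t\<^sup>2))"
proof (rule Bochner_Integration.integrable_bound)
  \<comment> \<open>The root cancels the normalising factor of the normal density; the exponential
    is the constant of the radial bound.\<close>
  define c where "c = sqrt (2 * pi * (2 * \<sigma>)\<^sup>2) * exp (1 / (2 * \<sigma>\<^sup>2))"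
  show "integrable lborel (\<lambda>t. c * (normal_density 0 (2 * \<sigma>) t * \<bar>t - 0\<bar> ^ q))"
    using \<sigma> by (intro integrable_mult_right integrable_normal_moment_abs) auto
  show "AE t in lborel. norm (indicator {0..} t * (t ^ q * exp (- (t - 1)\<^sup>2 / (2 * \<sigma>\<^sup>2))) * exp (s * t\<^sup>2))
      \<le> norm (c * (normal_density 0 (2 * \<sigma>) t * \<bar>t - 0\<bar> ^ q))"
  proof (rule AE_I2)
    fix t :: real
    have "norm (indicator {0..} t * (t ^ q * exp (- (t - 1)\<^sup>2 / (2 * \<sigma>\<^sup>2))) * exp (s * t\<^sup>2))
        \<le> \<bar>t\<bar> ^ q * (exp (s * t\<^sup>2) * exp (- (t - 1)\<^sup>2 / (2 * \<sigma>\<^sup>2)))"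
      by (simp add: abs_mult power_abs indicator_def)
    also have "\<dots> \<le> \<bar>t\<bar> ^ q * (exp (1 / (2 * \<sigma>\<^sup>2)) * exp (- t\<^sup>2 / (8 * \<sigma>\<^sup>2)))"
      by (intro mult_left_mono radial_weight_le \<sigma> s) auto
    also have "\<dots> = c * (normal_density 0 (2 * \<sigma>) t * \<bar>t - 0\<bar> ^ q)"
      using \<sigma> by (simp add: c_def normal_density_def power_mult_distrib)
    also have "\<dots> \<le> norm \<dots>" by simp
    finally show "norm (indicator {0..} t * (t ^ q * exp (- (t - 1)\<^sup>2 / (2 * \<sigma>\<^sup>2))) * exp (s * t\<^sup>2))
      \<le> norm (c * (normal_density 0 (2 * \<sigma>) t * \<bar>t - 0\<bar> ^ q))" .
  qed
qed simp

lemma J_int_eq: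
  "J_int q \<sigma> = (\<integral>t. indicator {0..} t * (t ^ q * exp (- (t - 1)\<^sup>2 / (2 * \<sigma>\<^sup>2))) \<partial>lborel)"
  by (simp add: J_int_def set_lebesgue_integral_def)

lemma integrable_J_int:
  fixes \<sigma> :: real
  assumes "0 < \<sigma>"
  shows "integrable lborel (\<lambda>t. indicator {0..} t * (t ^ q * exp (- (t - 1)\<^sup>2 / (2 * \<sigma>\<^sup>2))))"
  using integrable_radial_weight[OF assms, of 0 q] by simp

text \<open>A vanishing integral would make the nonnegative integrand zero almost everywhere, but it
  is positive between 1 and 2.\<close>

lemma J_int_pos:
  assumes "0 < \<sigma>"
  shows "0 < J_int q \<sigma>"
proof -
  let ?f = "\<lambda>t::real. indicator {0..} t * (t ^ q * exp (- (t - 1)\<^sup>2 / (2 * \<sigma>\<^sup>2)))"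
  have nonneg: "0 \<le> ?f t" for t by (simp add: indicator_def)
  have "J_int q \<sigma> \<noteq> 0"
  proof
    assume "J_int q \<sigma> = 0"
    then have "AE t in lborel. ?f t = 0"
      unfolding J_int_eq
      using integral_nonneg_eq_0_iff_AE[OF integrable_J_int[OF assms], of q] nonneg by simp
    then have "AE t in lborel. t \<notin> {1..2::real}"
      by eventually_elim auto
    then have "{1..2::real} \<in> null_sets lborel"
      by (subst AE_iff_null_sets) auto
    then show False by (simp add: null_sets_def)
  qed
  moreover have "0 \<le> J_int q \<sigma>"
    unfolding J_int_eq by (rule integral_nonneg_AE, rule AE_I2, rule nonneg)
  ultimately show ?thesis by simp
qed

section \<open>Radial law of the centred observation\<close>

text \<open>The law of an observation minus its centre, as a measure on the vector space, so that
  moments can be computed apart from any sample.\<close>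

definition ellipsoidal_law :: "real ^ 'n ^ 'n \<Rightarrow> real \<Rightarrow> (real ^ 'n) measure" where
  "ellipsoidal_law S \<sigma> = density lborel (\<lambda>y. ennreal (ellipsoidal_density 0 S \<sigma> y))"

lemma measurable_inv_norm [measurable]: "inv_norm S \<in> borel_measurable borel"
  using continuous_on_inv_norm by (rule borel_measurable_continuous_onI)

lemma measurable_ellipsoidal_density [measurable]: "ellipsoidal_density \<mu> S \<sigma> \<in> borel_measurable borel"
  unfolding ellipsoidal_density_def[abs_def] by measurable

lemma sets_ellipsoidal_law [simp, measurable_cong]: "sets (ellipsoidal_law S \<sigma>) = sets borel"
  by (simp add: ellipsoidal_law_def)

lemma space_ellipsoidal_law [simp]: "space (ellipsoidal_law S \<sigma>) = UNIV"
  by (simp add: ellipsoidal_law_def)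

context
  fixes S :: "real ^ 'n ^ 'n" and \<sigma> :: real
  assumes S: "sym_pos_def S" and \<sigma>: "0 < \<sigma>" and prob: "prob_space (ellipsoidal_law S \<sigma>)"
begin

text \<open>The image of Lebesgue measure and the radial profile of the density combine to
  \<open>\<kappa> * C * g r\<close>. Total mass one then determines the product
  \<open>\<kappa> * C\<close> as the reciprocal of the integral of \<open>g\<close>, with neither
  factor evaluated by itself.\<close>

lemma distr_ellipsoidal_law_inv_norm:
  "distr (ellipsoidal_law S \<sigma>) borel (inv_norm S) =
    density lborel (\<lambda>r. ennreal (indicator {0..} r * (r ^ (CARD('n) - 1) * exp (- (r - 1)\<^sup>2 / (2 * \<sigma>\<^sup>2)))
      / J_int (CARD('n) - 1) \<sigma>))"
proof -
  let ?q = "CARD('n) - 1"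
  define g where "g r = indicator {0..} r * (r ^ ?q * exp (- (r - 1)\<^sup>2 / (2 * \<sigma>\<^sup>2)))" for r :: real
  define C where "C = ellipsoidal_const S \<sigma>"
  have g [measurable]: "g \<in> borel_measurable borel"
    unfolding g_def[abs_def] by measurable
  have g_nonneg: "0 \<le> g r" for r by (simp add: g_def indicator_def)
  obtain m where m: "0 < m" "\<And>y. m * norm y \<le> inv_norm S y"
    using inv_norm_lower_bound[OF S] by blast
  obtain \<kappa> where \<kappa>: "0 \<le> \<kappa>"
    "distr lborel borel (inv_norm S) = density lborel (\<lambda>r. ennreal (\<kappa> * r ^ ?q) * indicator {0..} r)"
    using lborel_distr_homogeneous[OF continuous_on_inv_norm inv_norm_scaleR m] by auto
  have "distr (ellipsoidal_law S \<sigma>) borel (inv_norm S)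
      = density (distr lborel borel (inv_norm S)) (\<lambda>r. ennreal (C * exp (- (1 / (2 * \<sigma>\<^sup>2)) * (r - 1)\<^sup>2)))"
    unfolding ellipsoidal_law_def by (subst density_distr) (auto simp: ellipsoidal_density_def C_def)
  also have "\<dots> = density lborel (\<lambda>r. ennreal (\<kappa> * r ^ ?q) * indicator {0..} r
      * ennreal (C * exp (- (1 / (2 * \<sigma>\<^sup>2)) * (r - 1)\<^sup>2)))"
    unfolding \<kappa>(2) by (subst density_density_eq) auto
  also have "\<dots> = density lborel (\<lambda>r. ennreal (\<kappa> * C * g r))"
  proof (intro density_cong AE_I2)
    fix r :: real
    show "ennreal (\<kappa> * r ^ ?q) * indicator {0..} r * ennreal (C * exp (- (1 / (2 * \<sigma>\<^sup>2)) * (r - 1)\<^sup>2))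
        = ennreal (\<kappa> * C * g r)"
    proof (cases "0 \<le> r")
      case True
      then have "ennreal (\<kappa> * r ^ ?q) * ennreal (C * exp (- (1 / (2 * \<sigma>\<^sup>2)) * (r - 1)\<^sup>2))
        = ennreal (\<kappa> * r ^ ?q * (C * exp (- (1 / (2 * \<sigma>\<^sup>2)) * (r - 1)\<^sup>2)))"
        using \<kappa>(1) by (intro ennreal_mult'[symmetric]) simp
      then show ?thesis using True by (simp add: g_def mult_ac)
    qed (simp add: g_def)
  qed auto
  finally have eq: "distr (ellipsoidal_law S \<sigma>) borel (inv_norm S) = density lborel (\<lambda>r. ennreal (\<kappa> * C * g r))" .
  have int_g: "integrable lborel g" "integral\<^sup>L lborel g = J_int ?q \<sigma>"
    using integrable_J_int[OF \<sigma>, of ?q] unfolding J_int_eq g_def[abs_def] by auto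
  interpret prob_space "ellipsoidal_law S \<sigma>" by (rule prob)
  have "prob_space (density lborel (\<lambda>r. ennreal (\<kappa> * C * g r)))"
    unfolding eq[symmetric] by (rule prob_space_distr) simp
  from prob_space.emeasure_space_1[OF this]
  have mass: "(\<integral>\<^sup>+r. ennreal (\<kappa> * C * g r) \<partial>lborel) = 1"
    by (simp add: emeasure_density)
  \<comment> \<open>Otherwise \<open>ennreal\<close> would truncate the density to zero everywhere,
    against mass one.\<close>
  have "0 < \<kappa> * C"
  proof (rule ccontr)
    assume "\<not> 0 < \<kappa> * C"
    then have "\<kappa> * C * g r \<le> 0" for r :: real
      using g_nonneg[of r] by (intro mult_nonpos_nonneg[of "\<kappa> * C"]) simp_all
    then have "ennreal (\<kappa> * C * g r) = 0" for r by (rule ennreal_neg)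
    with mass show False by simp
  qed
  then have "(\<integral>\<^sup>+r. ennreal (\<kappa> * C * g r) \<partial>lborel) = ennreal (\<kappa> * C * J_int ?q \<sigma>)"
    using int_g g_nonneg by (subst nn_integral_eq_integral) auto
  with mass have "\<kappa> * C * J_int ?q \<sigma> = 1"
    using J_int_pos[OF \<sigma>, of ?q] \<open>0 < \<kappa> * C\<close> by (metis ennreal_eq_1)
  then have "\<kappa> * C = 1 / J_int ?q \<sigma>"
    using J_int_pos[OF \<sigma>, of ?q] by (simp add: field_simps)
  with eq show ?thesis by (simp add: g_def)
qed

lemma
  fixes h :: "real \<Rightarrow> real"
  assumes h [measurable]: "h \<in> borel_measurable borel"
  shows integral_ellipsoidal_law_radial: "(\<integral>y. h (inv_norm S y) \<partial>ellipsoidal_law S \<sigma>)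
    = (\<integral>r. indicator {0..} r * (r ^ (CARD('n) - 1) * exp (- (r - 1)\<^sup>2 / (2 * \<sigma>\<^sup>2))) * h r \<partial>lborel)
      / J_int (CARD('n) - 1) \<sigma>" (is ?int)
    and integrable_ellipsoidal_law_radial: "integrable (ellipsoidal_law S \<sigma>) (\<lambda>y. h (inv_norm S y)) \<longleftrightarrow>
      integrable lborel (\<lambda>r. indicator {0..} r * (r ^ (CARD('n) - 1) * exp (- (r - 1)\<^sup>2 / (2 * \<sigma>\<^sup>2))) * h r)"
      (is ?able)
proof -
  let ?J = "J_int (CARD('n) - 1) \<sigma>"
  let ?g = "\<lambda>r::real. indicator {0..} r * (r ^ (CARD('n) - 1) * exp (- (r - 1)\<^sup>2 / (2 * \<sigma>\<^sup>2)))"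
  have J: "0 < ?J" by (rule J_int_pos[OF \<sigma>])
  have nonneg: "0 \<le> ?g r / ?J" for r
    using J by (simp add: indicator_def)
  have "(\<integral>y. h (inv_norm S y) \<partial>ellipsoidal_law S \<sigma>) = (\<integral>r. h r \<partial>distr (ellipsoidal_law S \<sigma>) borel (inv_norm S))"
    by (subst integral_distr) auto
  also have "\<dots> = (\<integral>r. (?g r * h r) / ?J \<partial>lborel)"
    unfolding distr_ellipsoidal_law_inv_norm using nonneg by (subst integral_density) auto
  finally show ?int by simp
  have "integrable (ellipsoidal_law S \<sigma>) (\<lambda>y. h (inv_norm S y)) \<longleftrightarrow>
      integrable (distr (ellipsoidal_law S \<sigma>) borel (inv_norm S)) h"
    by (subst integrable_distr_eq) auto
  also have "\<dots> \<longleftrightarrow> integrable lborel (\<lambda>r. (?g r * h r) / ?J)"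
    unfolding distr_ellipsoidal_law_inv_norm using nonneg by (subst integrable_density) auto
  also have "\<dots> \<longleftrightarrow> integrable lborel (\<lambda>r. ?g r * h r)"
    using J integrable_mult_right_iff[of lborel "\<lambda>r. ?g r * h r" "1 / ?J"] by simp
  finally show ?able .
qed

text \<open>The power \<open>k\<close> of the radius joins the power \<open>CARD('n) - 1\<close> of
  the radial density, which shifts the index of \<open>J_int\<close>.\<close>

lemma
  shows integrable_inv_norm_power: "integrable (ellipsoidal_law S \<sigma>) (\<lambda>y. inv_norm S y ^ k)"
    and integral_inv_norm_power: "(\<integral>y. inv_norm S y ^ k \<partial>ellipsoidal_law S \<sigma>)
      = J_int (k + CARD('n) - 1) \<sigma> / J_int (CARD('n) - 1) \<sigma>"
proof -
  \<comment> \<open>Subtraction is truncated here; the identity rests on \<open>CARD('n)\<close>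
    being at least one.\<close>
  have exponent: "k + CARD('n) - 1 = CARD('n) - 1 + k"
    using zero_less_card_finite[where 'a='n] by linarith
  have eq: "indicator {0..} r * (r ^ (CARD('n) - 1) * exp (- (r - 1)\<^sup>2 / (2 * \<sigma>\<^sup>2))) * r ^ k
      = indicator {0..} r * (r ^ (k + CARD('n) - 1) * exp (- (r - 1)\<^sup>2 / (2 * \<sigma>\<^sup>2)))" for r :: real
    unfolding exponent by (simp only: power_add mult_ac)
  show "integrable (ellipsoidal_law S \<sigma>) (\<lambda>y. inv_norm S y ^ k)"
    by (subst integrable_ellipsoidal_law_radial) (use integrable_J_int[OF \<sigma>] in \<open>simp_all only: eq, auto\<close>)
  show "(\<integral>y. inv_norm S y ^ k \<partial>ellipsoidal_law S \<sigma>)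
      = J_int (k + CARD('n) - 1) \<sigma> / J_int (CARD('n) - 1) \<sigma>"
    by (subst integral_ellipsoidal_law_radial) (simp_all only: eq J_int_eq[symmetric], auto)
qed

lemma integrable_exp_inv_norm_square:
  assumes "s \<le> 1 / (8 * \<sigma>\<^sup>2)"
  shows "integrable (ellipsoidal_law S \<sigma>) (\<lambda>y. exp (s * (inv_norm S y)\<^sup>2))"
  using integrable_radial_weight[OF \<sigma> assms]
  by (subst integrable_ellipsoidal_law_radial) auto

lemma integrable_ellipsoidal_law_quadratic_growth:
  fixes h :: "real ^ 'n \<Rightarrow> real"
  assumes "h \<in> borel_measurable borel" "\<And>y. \<bar>h y\<bar> \<le> A + B * (inv_norm S y)\<^sup>2"
  shows "integrable (ellipsoidal_law S \<sigma>) h"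
proof (rule Bochner_Integration.integrable_bound)
  interpret prob_space "ellipsoidal_law S \<sigma>" by (rule prob)
  show "integrable (ellipsoidal_law S \<sigma>) (\<lambda>y. A + B * (inv_norm S y)\<^sup>2)"
    using integrable_inv_norm_power[of 2] by simp
  have "norm (h y) \<le> norm (A + B * (inv_norm S y)\<^sup>2)" for y
    using assms(2)[of y] by simp
  then show "AE y in ellipsoidal_law S \<sigma>. norm (h y) \<le> norm (A + B * (inv_norm S y)\<^sup>2)"
    by simp
qed (use assms(1) in simp)

end

section \<open>Symmetries, mean and covariance\<close>

text \<open>\<open>T\<close> preserves Lebesgue measure and, through \<open>inv_norm S\<close>, also
  the density, hence the whole law.\<close>

lemma integral_ellipsoidal_law_invariant:
  fixes S :: "real ^ 'n::{finite,wellorder} ^ 'n::_" and h :: "real ^ 'n::_ \<Rightarrow> real"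
  assumes lin: "linear T" and inv: "\<And>y. T (T y) = y" and N: "\<And>y. inv_norm S (T y) = inv_norm S y"
    and h [measurable]: "h \<in> borel_measurable borel"
  shows "(\<integral>y. h (T y) \<partial>ellipsoidal_law S \<sigma>) = (\<integral>y. h y \<partial>ellipsoidal_law S \<sigma>)"
proof -
  have T [measurable]: "T \<in> borel_measurable borel"
    using lin by (intro borel_measurable_continuous_onI linear_continuous_on)
      (simp add: linear_conv_bounded_linear)
  \<comment> \<open>Evaluating the density at \<open>T y\<close> instead of \<open>y\<close> lets it
    pass to the image measure.\<close>
  have "distr (ellipsoidal_law S \<sigma>) borel T
      = distr (density lborel (\<lambda>y. ennreal (ellipsoidal_density 0 S \<sigma> (T y)))) borel T"
    unfolding ellipsoidal_law_def by (simp add: ellipsoidal_density_def N)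
  also have "\<dots> = density (distr lborel borel T) (\<lambda>y. ennreal (ellipsoidal_density 0 S \<sigma> y))"
    by (subst density_distr) auto
  also have "\<dots> = ellipsoidal_law S \<sigma>"
    by (simp only: lborel_distr_linear_involution[OF lin inv] ellipsoidal_law_def)
  finally have "distr (ellipsoidal_law S \<sigma>) borel T = ellipsoidal_law S \<sigma>" .
  moreover have "(\<integral>y. h (T y) \<partial>ellipsoidal_law S \<sigma>) = (\<integral>y. h y \<partial>distr (ellipsoidal_law S \<sigma>) borel T)"
    by (subst integral_distr) auto
  ultimately show ?thesis by simp
qed

text \<open>For \<open>v\<close> and \<open>w\<close> of equal \<open>S\<close>-length, the map constructed here is the transpose of the
  \<open>S\<close>-orthogonal reflection exchanging \<open>v\<close> and \<open>w\<close>.\<close>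

lemma reflection_exists:
  fixes S :: "real ^ 'n ^ 'n"
  assumes S: "sym_pos_def S" and eq: "v \<bullet> (S *v v) = w \<bullet> (S *v w)" and ne: "v \<noteq> w"
  obtains T where "linear T" "\<And>y. T (T y) = y" "\<And>y. inv_norm S (T y) = inv_norm S y"
    "\<And>y. v \<bullet> T y = w \<bullet> y"
proof -
  note sym = inner_symmetric_matrix[OF sym_pos_defD(1)[OF S]]
  note sym_inv = inner_symmetric_matrix[OF sym_pos_defD(1)[OF sym_pos_def_matrix_inv[OF S]]]
  note inv = matrix_inv_mult_vec[OF sym_pos_defD(3)[OF S]]
  define a where "a = v - w"
  define q where "q = a \<bullet> (S *v a)"
  \<comment> \<open>The factor 2 together with the division by \<open>q\<close> makes
    \<open>a \<bullet> y\<close> change sign under \<open>T\<close>, from which the involution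
    property follows.\<close>
  define T where "T y = y - (2 * (a \<bullet> y) / q) *\<^sub>R (S *v a)" for y
  have q: "0 < q"
    using sym_pos_defD(2)[OF S, of a] ne by (simp add: q_def a_def)
  have "linear T"
    unfolding T_def[abs_def] linear_iff
    by (simp add: inner_add_right algebra_simps add_divide_distrib)
  moreover have aT: "a \<bullet> T y = - (a \<bullet> y)" for y
    using q by (simp add: T_def inner_diff_right q_def[symmetric])
  then have "T (T y) = y" for y
    unfolding T_def[of "T y"] by (simp add: T_def)
  moreover have "inv_norm S (T y) = inv_norm S y" for y
  proof -
    define t where "t = 2 * (a \<bullet> y) / q"
    have tq: "t * q = 2 * (a \<bullet> y)" using q by (simp add: t_def)
    have cross: "(S *v a) \<bullet> (matrix_inv S *v y) = a \<bullet> y"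
      using sym[of a "matrix_inv S *v y"] by (simp add: inv)
    have "T y \<bullet> (matrix_inv S *v T y)
      = y \<bullet> (matrix_inv S *v y) - t * (y \<bullet> a) - t * ((S *v a) \<bullet> (matrix_inv S *v y)) + t * (t * ((S *v a) \<bullet> a))"
      unfolding T_def t_def[symmetric]
      by (simp add: matrix_vector_mult_diff_distrib matrix_vector_mult_scaleR inv inner_diff_left inner_diff_right
          algebra_simps)
    also have "\<dots> = y \<bullet> (matrix_inv S *v y) - 2 * t * (a \<bullet> y) + t * (t * q)"
      by (simp add: cross q_def inner_commute)
    also have "\<dots> = y \<bullet> (matrix_inv S *v y)"
      by (simp add: tq)
    finally show ?thesis by (simp add: inv_norm_def)
  qed
  moreover have "v \<bullet> T y = w \<bullet> y" for y
  proof -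
    have "w \<bullet> (S *v v) = v \<bullet> (S *v w)"
      by (metis sym inner_commute)
    \<comment> \<open>Here the equal lengths of \<open>v\<close> and \<open>w\<close> enter:
      \<open>T\<close> then lowers \<open>v \<bullet> y\<close> by exactly
      \<open>a \<bullet> y\<close>.\<close>
    then have "q = 2 * (v \<bullet> (S *v a))"
      using eq by (simp add: q_def a_def matrix_vector_mult_diff_distrib inner_diff_left inner_diff_right)
    then have "v \<bullet> T y = v \<bullet> y - a \<bullet> y"
      using q by (simp add: T_def inner_diff_right)
    then show ?thesis by (simp add: a_def inner_diff_left)
  qed
  ultimately show thesis by (rule that)
qed

text \<open>The law is invariant under negation and the component is odd, so the integral equals its
  own negative.\<close>

lemma integral_ellipsoidal_law_component:
  fixes S :: "real ^ 'n::{finite,wellorder} ^ 'n::_"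
  shows "(\<integral>y. y $ i \<partial>ellipsoidal_law S \<sigma>) = 0"
proof -
  have "(\<integral>y. (- y) $ i \<partial>ellipsoidal_law S \<sigma>) = (\<integral>y. y $ i \<partial>ellipsoidal_law S \<sigma>)"
    by (rule integral_ellipsoidal_law_invariant) (auto simp: inv_norm_minus intro!: linearI)
  then show ?thesis by simp
qed

lemma norm_le_inv_norm:
  fixes S :: "real ^ 'n ^ 'n"
  assumes S: "sym_pos_def S"
  obtains B where "0 < B" "\<And>y. norm y \<le> B * inv_norm S y"
proof -
  obtain m where m: "0 < m" "\<And>y. m * norm y \<le> inv_norm S y"
    using inv_norm_lower_bound[OF S] by blast
  show thesis
    by (rule that[of "1 / m"]) (use m in \<open>auto simp: field_simps\<close>)
qed

text \<open>By symmetry of \<open>S\<close> the double sum is the trace of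
  \<open>matrix_inv S ** S\<close>, that is, of the identity.\<close>

lemma sum_matrix_inv_mult:
  fixes S :: "real ^ 'n ^ 'n"
  assumes sym: "transpose S = S" and inv: "invertible S"
  shows "(\<Sum>k\<in>UNIV. \<Sum>l\<in>UNIV. matrix_inv S $ k $ l * S $ k $ l) = real CARD('n)"
proof -
  have "(\<Sum>l\<in>UNIV. matrix_inv S $ k $ l * S $ k $ l) = (matrix_inv S ** S) $ k $ k" for k
    unfolding matrix_matrix_mult_def
    by (simp, intro sum.cong refl) (metis sym transpose_def vec_lambda_beta)
  then show ?thesis
    by (simp add: matrix_inv_invertible(2)[OF inv] mat_def)
qed

text \<open>Reflections show that the second moment \<open>Q v\<close> in direction \<open>v\<close>
  depends on \<open>q v\<close> alone; both are homogeneous of degree two, so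
  \<open>Q = c * q\<close>. Polarisation yields the entries, and the trace against
  \<open>matrix_inv S\<close> expresses \<open>c\<close> by the second moment of the length.\<close>

lemma integral_ellipsoidal_law_covariance:
  fixes S :: "real ^ 'n::{finite,wellorder} ^ 'n::_"
  assumes S: "sym_pos_def S" and \<sigma>: "0 < \<sigma>" and prob: "prob_space (ellipsoidal_law S \<sigma>)"
  shows "(\<integral>y. y $ i * y $ j \<partial>ellipsoidal_law S \<sigma>)
    = J_int (CARD('n) + 1) \<sigma> / (real CARD('n) * J_int (CARD('n) - 1) \<sigma>) * S $ i $ j"
proof -
  let ?D = "ellipsoidal_law S \<sigma>"
  define q where "q v = v \<bullet> (S *v v)" for v
  define Q where "Q v = (\<integral>y. (v \<bullet> y)\<^sup>2 \<partial>?D)" for v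
  obtain B where B: "0 < B" "\<And>y. norm y \<le> B * inv_norm S y"
    using norm_le_inv_norm[OF S] by blast
  have int: "integrable ?D (\<lambda>y. (v \<bullet> y) * (w \<bullet> y))" for v w
  proof (rule integrable_ellipsoidal_law_quadratic_growth[OF S \<sigma> prob])
    fix y
    have "\<bar>(v \<bullet> y) * (w \<bullet> y)\<bar> \<le> (norm v * norm y) * (norm w * norm y)"
      unfolding abs_mult by (intro mult_mono Cauchy_Schwarz_ineq2) auto
    also have "\<dots> = norm v * norm w * (norm y)\<^sup>2"
      by (simp add: power2_eq_square)
    also have "\<dots> \<le> norm v * norm w * (B * inv_norm S y)\<^sup>2"
      by (intro mult_left_mono power_mono B) auto
    finally show "\<bar>(v \<bullet> y) * (w \<bullet> y)\<bar> \<le> 0 + (norm v * norm w * B\<^sup>2) * (inv_norm S y)\<^sup>2"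
      by (simp add: power_mult_distrib mult.assoc)
  qed simp
  have Q_eq: "Q v = Q w" if "q v = q w" for v w
  proof (cases "v = w")
    case False
    obtain T where T: "linear T" "\<And>y. T (T y) = y" "\<And>y. inv_norm S (T y) = inv_norm S y"
      "\<And>y. v \<bullet> T y = w \<bullet> y"
      using reflection_exists[OF S, of v w] \<open>q v = q w\<close> False unfolding q_def by blast
    have "(\<integral>y. (v \<bullet> T y)\<^sup>2 \<partial>?D) = Q v"
      unfolding Q_def by (rule integral_ellipsoidal_law_invariant[OF T(1-3)]) simp
    then show ?thesis by (simp add: T(4) Q_def)
  qed simp
  have Q_scale: "Q (c *\<^sub>R v) = c\<^sup>2 * Q v" for c v
    by (simp add: Q_def power_mult_distrib)
  have q_scale: "q (c *\<^sub>R v) = c\<^sup>2 * q v" for c v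
    by (simp add: q_def matrix_vector_mult_scaleR power2_eq_square)
  have q_pos: "0 < q v" if "v \<noteq> 0" for v
    unfolding q_def using that by (rule sym_pos_defD(2)[OF S])
  \<comment> \<open>A reference direction fixing the ratio \<open>c\<close>; any nonzero vector has
    the same \<open>q\<close> as a multiple of it.\<close>
  define e where "e = axis i (1 :: real)"
  have e: "0 < q e" by (rule q_pos) (simp add: e_def axis_eq_0_iff)
  define c where "c = Q e / q e"
  have Q_q: "Q v = c * q v" for v
  proof (cases "v = 0")
    case False
    let ?s = "sqrt (q v / q e)"
    have s: "?s\<^sup>2 = q v / q e" using e q_pos[OF False] by simp
    have "q v = q (?s *\<^sub>R e)" unfolding q_scale s using e by simp
    then have "Q v = Q (?s *\<^sub>R e)" by (rule Q_eq)
    also have "\<dots> = c * q v" unfolding Q_scale s by (simp add: c_def)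
    finally show ?thesis .
  qed (simp add: Q_def q_def)
  have cov: "(\<integral>y. y $ k * y $ l \<partial>?D) = c * S $ k $ l" for k l
  proof -
    let ?u = "axis k (1::real)" and ?w = "axis l (1::real)"
    have sym: "S $ l $ k = S $ k $ l"
      using sym_pos_defD(1)[OF S] by (metis transpose_def vec_lambda_beta)
    have q_axis: "?u \<bullet> (S *v ?w) = S $ k $ l" "?w \<bullet> (S *v ?u) = S $ l $ k"
      by (simp_all add: inner_axis' matrix_vector_mult_basis column_def)
    \<comment> \<open>Polarisation: the mixed moment is read off from \<open>Q\<close> at the sum of
      two axis vectors.\<close>
    have "Q (?u + ?w) = (\<integral>y. (?u \<bullet> y) * (?u \<bullet> y) + (?w \<bullet> y) * (?w \<bullet> y) + 2 * ((?u \<bullet> y) * (?w \<bullet> y)) \<partial>?D)"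
      unfolding Q_def
      by (intro Bochner_Integration.integral_cong refl) (simp add: inner_add_left power2_eq_square algebra_simps)
    also have "\<dots> = (\<integral>y. (?u \<bullet> y) * (?u \<bullet> y) \<partial>?D) + (\<integral>y. (?w \<bullet> y) * (?w \<bullet> y) \<partial>?D)
        + 2 * (\<integral>y. (?u \<bullet> y) * (?w \<bullet> y) \<partial>?D)"
      using int by (simp only: Bochner_Integration.integral_add Bochner_Integration.integrable_add
          integrable_mult_right integral_mult_right_zero)
    also have "\<dots> = Q ?u + Q ?w + 2 * (\<integral>y. y $ k * y $ l \<partial>?D)"
      by (simp add: Q_def power2_eq_square inner_axis')
    finally have "2 * (\<integral>y. y $ k * y $ l \<partial>?D) = c * (q (?u + ?w) - q ?u - q ?w)"
      by (simp add: Q_q algebra_simps)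
    also have "q (?u + ?w) - q ?u - q ?w = 2 * S $ k $ l"
      unfolding q_def using q_axis sym
      by (simp add: matrix_vector_right_distrib inner_add_left inner_add_right)
    finally show ?thesis by simp
  qed
  let ?P = "matrix_inv S"
  have int_kl: "integrable ?D (\<lambda>y. y $ k * y $ l)" for k l
    using int[of "axis k 1" "axis l 1"] by (simp add: inner_axis')
  \<comment> \<open>Integrated, this expansion equates the known second moment of the length with
    \<open>c\<close> times a trace.\<close>
  have "(inv_norm S y)\<^sup>2 = (\<Sum>k\<in>UNIV. \<Sum>l\<in>UNIV. ?P $ k $ l * (y $ k * y $ l))" for y
    by (simp add: inv_norm_power2[OF S] inner_vec_def matrix_vector_mult_def sum_distrib_left mult_ac)
  then have "(\<integral>y. (inv_norm S y)\<^sup>2 \<partial>?D) = (\<Sum>k\<in>UNIV. \<Sum>l\<in>UNIV. ?P $ k $ l * (\<integral>y. y $ k * y $ l \<partial>?D))"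
    using int_kl by (simp add: Bochner_Integration.integral_sum)
  also have "\<dots> = c * (\<Sum>k\<in>UNIV. \<Sum>l\<in>UNIV. ?P $ k $ l * S $ k $ l)"
    unfolding cov by (simp add: sum_distrib_left mult_ac)
  finally have "(\<integral>y. (inv_norm S y)\<^sup>2 \<partial>?D) = c * real CARD('n)"
    by (simp only: sum_matrix_inv_mult[OF sym_pos_defD(1,3)[OF S]])
  moreover have "2 + CARD('n) - 1 = CARD('n) + 1" by simp
  ultimately have "c * real CARD('n) = J_int (CARD('n) + 1) \<sigma> / J_int (CARD('n) - 1) \<sigma>"
    using integral_inv_norm_power[OF S \<sigma> prob, of 2] by simp
  then have "c = J_int (CARD('n) + 1) \<sigma> / (real CARD('n) * J_int (CARD('n) - 1) \<sigma>)"
    using zero_less_card_finite[where 'a='n] J_int_pos[OF \<sigma>, of "CARD('n) - 1"]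
    by (simp add: field_simps)
  then show ?thesis by (simp only: cov)
qed

section \<open>Iterated logarithm for functions of the observations\<close>

text \<open>The length has Gaussian tails, so a function of at most quadratic growth in it has an
  exponential moment, and the bound for centred variables applies to \<open>h\<close> minus its
  mean.\<close>

lemma (in prob_space) lil_ellipsoidal_law:
  fixes S :: "real ^ 'n ^ 'n" and X :: "nat \<Rightarrow> 'a \<Rightarrow> real ^ 'n" and h :: "real ^ 'n \<Rightarrow> real"
  assumes S: "sym_pos_def S" and \<sigma>: "0 < \<sigma>"
    and indep: "indep_vars (\<lambda>_. borel) X {1..}"
    and law: "\<And>i. 1 \<le> i \<Longrightarrow> distr M borel (\<lambda>\<omega>. X i \<omega> - \<mu>) = ellipsoidal_law S \<sigma>"
    and h [measurable]: "h \<in> borel_measurable borel"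
    and growth: "\<And>y. \<bar>h y\<bar> \<le> A + B * (inv_norm S y)\<^sup>2" "0 \<le> B"
  shows "AE \<omega> in M. (\<lambda>n. (1 / real n) * (\<Sum>i=1..n. h (X i \<omega> - \<mu>)) - (\<integral>y. h y \<partial>ellipsoidal_law S \<sigma>)) \<in> O(lil_rate)"
proof -
  let ?D = "ellipsoidal_law S \<sigma>"
  have rv [measurable]: "X i \<in> borel_measurable M" if "1 \<le> i" for i
    using indep that by (auto simp: indep_vars_def)
  have "prob_space (distr M borel (\<lambda>\<omega>. X 1 \<omega> - \<mu>))"
    by (rule prob_space_distr) simp
  then have prob: "prob_space ?D" by (simp only: law[OF order_refl])
  then interpret D: prob_space ?D .
  have int_h: "integrable ?D h"
    by (rule integrable_ellipsoidal_law_quadratic_growth[OF S \<sigma> prob h growth(1)])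
  define c where "c = (\<integral>y. h y \<partial>?D)"
  \<comment> \<open>Small enough that \<open>t * B\<close> stays in the range where the exponential
    of the squared length is integrable; \<open>B + 1\<close> keeps the denominator positive when
    \<open>B = 0\<close>.\<close>
  define t where "t = 1 / (8 * \<sigma>\<^sup>2 * (B + 1))"
  have t: "0 < t" using \<sigma> growth(2) by (simp add: t_def)
  have tB: "t * B \<le> 1 / (8 * \<sigma>\<^sup>2)"
  proof -
    have "t * B = 1 / (8 * \<sigma>\<^sup>2) * (B / (B + 1))"
      by (simp add: t_def)
    also have "\<dots> \<le> 1 / (8 * \<sigma>\<^sup>2)"
      using growth(2) by (intro mult_left_le) auto
    finally show ?thesis .
  qed
  have exp_le: "exp (t * \<bar>h y - c\<bar>) \<le> exp (t * (A + \<bar>c\<bar>)) * exp (t * B * (inv_norm S y)\<^sup>2)" for y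
  proof -
    have "t * \<bar>h y - c\<bar> \<le> t * (A + \<bar>c\<bar> + B * (inv_norm S y)\<^sup>2)"
      using growth(1)[of y] t by (intro mult_left_mono) auto
    then show ?thesis
      by (simp add: exp_add[symmetric] algebra_simps)
  qed
  have int_exp: "integrable ?D (\<lambda>y. exp (t * \<bar>h y - c\<bar>))"
  proof (rule Bochner_Integration.integrable_bound)
    show "integrable ?D (\<lambda>y. exp (t * (A + \<bar>c\<bar>)) * exp (t * B * (inv_norm S y)\<^sup>2))"
      by (intro integrable_mult_right integrable_exp_inv_norm_square[OF S \<sigma> prob tB])
    show "AE y in ?D. norm (exp (t * \<bar>h y - c\<bar>)) \<le> norm (exp (t * (A + \<bar>c\<bar>)) * exp (t * B * (inv_norm S y)\<^sup>2))"
      using exp_le by simp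
  qed simp
  have transfer: "integrable M (\<lambda>\<omega>. g (X i \<omega> - \<mu>)) \<longleftrightarrow> integrable ?D g"
    "expectation (\<lambda>\<omega>. g (X i \<omega> - \<mu>)) = (\<integral>y. g y \<partial>?D)"
    if "1 \<le> i" "g \<in> borel_measurable borel" for i and g :: "real ^ 'n \<Rightarrow> real"
    unfolding law[OF that(1), symmetric] using that rv[OF that(1)]
    by (simp_all add: integrable_distr_eq integral_distr)
  have "AE \<omega> in M. (\<lambda>n. (1 / real n) * (\<Sum>i=1..n. h (X i \<omega> - \<mu>) - c)) \<in> O(lil_rate)"
  proof (rule lil_upper_bound[OF _ t])
    show "indep_vars (\<lambda>_. borel) (\<lambda>i \<omega>. h (X i \<omega> - \<mu>) - c) {1..}"
      by (rule indep_vars_compose2[OF indep]) simp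
    fix i :: nat assume i: "1 \<le> i"
    show "expectation (\<lambda>\<omega>. h (X i \<omega> - \<mu>) - c) = 0"
      using transfer(2)[OF i, of "\<lambda>y. h y - c"] int_h D.prob_space by (simp add: c_def)
    show "integrable M (\<lambda>\<omega>. exp (t * \<bar>h (X i \<omega> - \<mu>) - c\<bar>))"
      using transfer(1)[OF i, of "\<lambda>y. exp (t * \<bar>h y - c\<bar>)"] int_exp by simp
    show "expectation (\<lambda>\<omega>. exp (t * \<bar>h (X i \<omega> - \<mu>) - c\<bar>)) \<le> (\<integral>y. exp (t * \<bar>h y - c\<bar>) \<partial>?D)"
      using transfer(2)[OF i, of "\<lambda>y. exp (t * \<bar>h y - c\<bar>)"] by simp
  qed
  then show ?thesis
  proof eventually_elim
    case (elim \<omega>)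
    \<comment> \<open>Averaging the constant \<open>c\<close> gives \<open>c\<close> back only for
      positive \<open>n\<close>.\<close>
    have "\<forall>\<^sub>F n in sequentially. (1 / real n) * (\<Sum>i=1..n. h (X i \<omega> - \<mu>) - c)
        = (1 / real n) * (\<Sum>i=1..n. h (X i \<omega> - \<mu>)) - c"
      using eventually_gt_at_top[of 0]
      by eventually_elim (simp add: sum_subtractf field_simps)
    from landau_o.big.in_cong[OF this] elim show ?case by (simp add: c_def)
  qed
qed

text \<open>The density depends on \<open>x - \<mu>\<close> only, and Lebesgue measure is invariant
  under translation.\<close>

lemma (in prob_space) distr_ellipsoidal_density_centered:
  fixes X :: "'a \<Rightarrow> real ^ 'n"
  assumes "distributed M lborel X (\<lambda>x. ennreal (ellipsoidal_density \<mu> S \<sigma> x))"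
  shows "distr M borel (\<lambda>\<omega>. X \<omega> - \<mu>) = ellipsoidal_law S \<sigma>"
proof -
  have X: "X \<in> borel_measurable M" "distr M lborel X = density lborel (\<lambda>x. ennreal (ellipsoidal_density \<mu> S \<sigma> x))"
    using assms by (auto simp: distributed_def)
  have "distr M borel (\<lambda>\<omega>. X \<omega> - \<mu>) = distr (distr M lborel X) borel (\<lambda>x. x - \<mu>)"
    using X(1) by (subst distr_distr) (auto simp: comp_def)
  also have "\<dots> = distr (density lborel (\<lambda>x. ennreal (ellipsoidal_density 0 S \<sigma> (x - \<mu>)))) borel (\<lambda>x. x - \<mu>)"
    unfolding X(2) by (simp add: ellipsoidal_density_def)
  also have "\<dots> = density (distr lborel borel (\<lambda>x. x - \<mu>)) (\<lambda>x. ennreal (ellipsoidal_density 0 S \<sigma> x))"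
    by (subst density_distr) auto
  also have "distr lborel borel (\<lambda>x. x - \<mu>) = lborel"
  proof -
    have "(\<lambda>x. x - \<mu>) = (+) (- \<mu>)" by auto
    then show ?thesis by (simp only: lborel_distr_plus)
  qed
  finally show ?thesis by (simp add: ellipsoidal_law_def)
qed

section \<open>Perturbation of the estimators\<close>

lemma lil_rate_bounded: "f \<in> O(lil_rate) \<Longrightarrow> f \<in> O(\<lambda>_. 1)" for f :: "nat \<Rightarrow> real"
proof -
  have "lil_rate \<in> O(\<lambda>_. 1)"
    unfolding lil_rate_def[abs_def] by real_asymp
  then show "f \<in> O(lil_rate) \<Longrightarrow> f \<in> O(\<lambda>_. 1)"
    by (rule landau_o.big_trans[rotated])
qed

lemma lil_rate_tendsto_0: "f \<in> O(lil_rate) \<Longrightarrow> f \<longlonglongrightarrow> 0" for f :: "nat \<Rightarrow> real"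
proof -
  assume f: "f \<in> O(lil_rate)"
  have "lil_rate \<in> o(\<lambda>_. 1)"
    unfolding lil_rate_def[abs_def] by real_asymp
  with f have "f \<in> o(\<lambda>_. 1)" by (rule landau_o.big_small_trans)
  then show "f \<longlonglongrightarrow> 0" by (rule smalloD_tendsto[where g="\<lambda>_. 1", simplified])
qed

lemma lil_rate_mult:
  fixes f g :: "nat \<Rightarrow> real"
  assumes "f \<in> O(lil_rate)" "g \<in> O(\<lambda>_. 1)"
  shows "(\<lambda>n. f n * g n) \<in> O(lil_rate)"
  using landau_o.big.mult[OF assms] by simp

lemma bigo_const_1: "(\<lambda>_. c) \<in> O(\<lambda>_. 1)" for c :: real
  by simp

lemma bounded_of_lil_rate_diff:
  fixes f :: "nat \<Rightarrow> real"
  assumes "(\<lambda>n. f n - c) \<in> O(lil_rate)"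
  shows "f \<in> O(\<lambda>_. 1)"
proof -
  have "(\<lambda>n. (f n - c) + c) \<in> O(\<lambda>_. 1)"
    by (intro sum_in_bigo lil_rate_bounded assms bigo_const_1)
  then show ?thesis by simp
qed

lemma bigo_of_eventually_abs_le:
  fixes f g :: "nat \<Rightarrow> real"
  assumes "\<forall>\<^sub>F n in sequentially. \<bar>f n\<bar> \<le> g n" "g \<in> O(h)"
  shows "f \<in> O(h)"
proof (rule landau_o.big_trans[OF _ assms(2)], rule bigoI[of _ 1])
  show "\<forall>\<^sub>F n in sequentially. norm (f n) \<le> 1 * norm (g n)"
    using assms(1) by eventually_elim auto
qed

section \<open>Stability of the length under changes of matrix and vector\<close>

lemma spectral_norm_nonneg: "0 \<le> spectral_norm A"
  unfolding spectral_norm_def by (rule onorm_pos_le[OF matrix_vector_mul_bounded_linear])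

lemma norm_mult_vec_le: "norm (A *v v) \<le> spectral_norm A * norm v"
  unfolding spectral_norm_def by (rule onorm[OF matrix_vector_mul_bounded_linear])

lemma spectral_norm_le_sum: "spectral_norm A \<le> (\<Sum>i\<in>UNIV. \<Sum>j\<in>UNIV. \<bar>A $ i $ j\<bar>)"
  unfolding spectral_norm_def by (rule onorm_le_matrix_component_sum)

text \<open>Coercivity at \<open>u = matrix_inv A *v w\<close> and Cauchy-Schwarz give
  \<open>m * (norm u)\<^sup>2 \<le> norm u * norm w\<close>.\<close>

lemma norm_matrix_inv_le:
  fixes A :: "real ^ 'n ^ 'n"
  assumes m: "0 < m" "\<And>v. m * (norm v)\<^sup>2 \<le> v \<bullet> (A *v v)" and inv: "invertible A"
  shows "norm (matrix_inv A *v w) \<le> norm w / m"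
proof (cases "matrix_inv A *v w = 0")
  case False
  let ?u = "matrix_inv A *v w"
  have "m * (norm ?u)\<^sup>2 \<le> ?u \<bullet> w"
    using m(2)[of ?u] by (simp add: matrix_inv_mult_vec[OF inv])
  also have "\<dots> \<le> norm ?u * norm w" by (rule norm_cauchy_schwarz)
  finally have "m * norm ?u \<le> norm w"
    using False by (simp add: power2_eq_square)
  then show ?thesis using m(1) by (simp add: field_simps)
qed (use m(1) in simp)

text \<open>The quadratic form of \<open>A - A0\<close> is at most
  \<open>m / 2 * (norm v)\<^sup>2\<close> in absolute value, so half of the coercivity
  survives.\<close>

lemma pos_def_perturb:
  fixes A A0 :: "real ^ 'n ^ 'n"
  assumes m: "\<And>v. m * (norm v)\<^sup>2 \<le> v \<bullet> (A0 *v v)" and close: "spectral_norm (A - A0) \<le> m / 2"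
  shows "m / 2 * (norm v)\<^sup>2 \<le> v \<bullet> (A *v v)"
proof -
  have "\<bar>v \<bullet> ((A - A0) *v v)\<bar> \<le> norm v * norm ((A - A0) *v v)"
    by (rule Cauchy_Schwarz_ineq2)
  also have "\<dots> \<le> norm v * (spectral_norm (A - A0) * norm v)"
    by (intro mult_left_mono norm_mult_vec_le) simp
  also have "\<dots> \<le> norm v * (m / 2 * norm v)"
    by (intro mult_left_mono mult_right_mono close) simp_all
  finally have "\<bar>v \<bullet> ((A - A0) *v v)\<bar> \<le> m / 2 * (norm v)\<^sup>2"
    by (simp add: power2_eq_square mult_ac)
  moreover have "v \<bullet> ((A - A0) *v v) = v \<bullet> (A *v v) - v \<bullet> (A0 *v v)"
    by (simp add: matrix_vector_mult_diff_rdistrib inner_diff_right)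
  ultimately show ?thesis using m[of v] by linarith
qed

lemma abs_diff_le_of_squares:
  fixes \<alpha> \<beta> D k :: real
  assumes "0 \<le> \<alpha>" "0 < k" "k \<le> \<beta>" "\<bar>\<alpha>\<^sup>2 - \<beta>\<^sup>2\<bar> \<le> D"
  shows "\<bar>\<alpha> - \<beta>\<bar> \<le> D / k"
proof -
  have "\<bar>\<alpha> - \<beta>\<bar> * k \<le> \<bar>\<alpha> - \<beta>\<bar> * (\<alpha> + \<beta>)"
    using assms by (intro mult_left_mono) auto
  also have "\<dots> = \<bar>\<alpha>\<^sup>2 - \<beta>\<^sup>2\<bar>"
    using assms by (simp add: power2_eq_square square_diff_square_factored abs_mult)
  also have "\<dots> \<le> D" by fact
  finally show ?thesis using assms(2) by (simp add: pos_le_divide_eq)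
qed

text \<open>The resolvent identity writes the difference of the inverses as
  \<open>matrix_inv A ** (A0 - A) ** matrix_inv A0\<close>, so the squared lengths differ by order
  \<open>spectral_norm (A - A0) * (norm z)\<^sup>2\<close>. Division by the lower bound
  \<open>k * norm z\<close> for the second length makes this linear in
  \<open>norm z\<close>.\<close>

lemma inv_norm_perturb_matrix:
  fixes A0 :: "real ^ 'n ^ 'n"
  assumes A0: "sym_pos_def A0" and m: "0 < m" "\<And>v. m * (norm v)\<^sup>2 \<le> v \<bullet> (A0 *v v)"
  obtains C where "0 \<le> C" "\<And>A z. spectral_norm (A - A0) \<le> m / 2 \<Longrightarrow>
    \<bar>inv_norm A z - inv_norm A0 z\<bar> \<le> C * spectral_norm (A - A0) * norm z"
proof -
  obtain k where k: "0 < k" "\<And>y. k * norm y \<le> inv_norm A0 y"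
    using inv_norm_lower_bound[OF A0] by blast
  have inv0: "invertible A0" by (rule sym_pos_defD(3)[OF A0])
  have "\<bar>inv_norm A z - inv_norm A0 z\<bar> \<le> 2 / (m\<^sup>2 * k) * spectral_norm (A - A0) * norm z"
    if close: "spectral_norm (A - A0) \<le> m / 2" for A z
  proof (cases "z = 0")
    case False
    let ?P = "matrix_inv A" and ?R = "matrix_inv A0" and ?d = "spectral_norm (A - A0)"
    have pd: "m / 2 * (norm v)\<^sup>2 \<le> v \<bullet> (A *v v)" for v
      by (rule pos_def_perturb[OF m(2) close])
    have inv: "invertible A"
    proof (rule pos_def_invertible)
      fix x :: "real ^ 'n" assume "x \<noteq> 0"
      then have "0 < m / 2 * (norm x)\<^sup>2" using m(1) by simp
      then show "0 < x \<bullet> (A *v x)" using pd[of x] by linarith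
    qed
    \<comment> \<open>\<open>A\<close> need not be symmetric, so the sign of the form of its inverse
      is taken from coercivity at \<open>matrix_inv A *v z\<close>.\<close>
    have nonneg: "0 \<le> z \<bullet> (?P *v z)"
    proof -
      have "0 \<le> m / 2 * (norm (?P *v z))\<^sup>2" using m(1) by simp
      also have "\<dots> \<le> (?P *v z) \<bullet> (A *v (?P *v z))" by (rule pd)
      finally show ?thesis by (simp add: matrix_inv_mult_vec[OF inv] inner_commute)
    qed
    have "?P *v ((A0 - A) *v (?R *v z)) = ?P *v z - ?R *v z"
      by (simp add: matrix_vector_mult_diff_rdistrib matrix_vector_mult_diff_distrib
          matrix_inv_mult_vec[OF inv] matrix_inv_mult_vec[OF inv0])
    moreover have "norm ((A0 - A) *v (?R *v z)) = norm ((A - A0) *v (?R *v z))"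
      by (simp add: matrix_vector_mult_diff_rdistrib norm_minus_commute)
    ultimately have "norm (?P *v z - ?R *v z) \<le> norm ((A - A0) *v (?R *v z)) / (m / 2)"
      using norm_matrix_inv_le[of "m / 2" A "(A0 - A) *v (?R *v z)"] m(1) pd inv by simp
    also have "\<dots> \<le> ?d * norm (?R *v z) / (m / 2)"
      using m(1) by (intro divide_right_mono norm_mult_vec_le) simp
    also have "\<dots> \<le> ?d * (norm z / m) / (m / 2)"
      using m(1) by (intro divide_right_mono mult_left_mono norm_matrix_inv_le[OF m inv0] spectral_norm_nonneg) simp
    finally have diff: "norm (?P *v z - ?R *v z) \<le> ?d * (norm z / m) / (m / 2)" .
    have "(inv_norm A z)\<^sup>2 = z \<bullet> (?P *v z)"
      using nonneg by (simp add: inv_norm_def)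
    then have "\<bar>(inv_norm A z)\<^sup>2 - (inv_norm A0 z)\<^sup>2\<bar> = \<bar>z \<bullet> (?P *v z - ?R *v z)\<bar>"
      by (simp only: inv_norm_power2[OF A0] inner_diff_right)
    also have "\<dots> \<le> norm z * norm (?P *v z - ?R *v z)" by (rule Cauchy_Schwarz_ineq2)
    also have "\<dots> \<le> norm z * (?d * (norm z / m) / (m / 2))"
      by (intro mult_left_mono diff) simp
    finally have "\<bar>inv_norm A z - inv_norm A0 z\<bar> \<le> norm z * (?d * (norm z / m) / (m / 2)) / (k * norm z)"
      using k False nonneg by (intro abs_diff_le_of_squares) (simp_all add: inv_norm_def)
    also have "\<dots> = 2 / (m\<^sup>2 * k) * ?d * norm z"
      using False k(1) m(1) by (simp add: field_simps power2_eq_square)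
    finally show ?thesis .
  qed (simp add: inv_norm_def)
  moreover have "0 \<le> 2 / (m\<^sup>2 * k)" using k(1) m(1) by simp
  ultimately show thesis by (intro that) blast+
qed

text \<open>The difference of squares is bilinear in \<open>b\<close> and
  \<open>(z - b) + z\<close>. The quantity \<open>s\<close> bounds the norm of the latter, while
  \<open>k * s\<close> is below the sum of the two lengths; \<open>s\<close> cancels and the
  constant does not depend on \<open>z\<close>.\<close>

lemma inv_norm_perturb_vector:
  fixes A0 :: "real ^ 'n ^ 'n"
  assumes A0: "sym_pos_def A0"
  obtains C where "0 \<le> C" "\<And>z b. \<bar>inv_norm A0 (z - b) - inv_norm A0 z\<bar> \<le> C * norm b"
proof -
  obtain k where k: "0 < k" "\<And>y. k * norm y \<le> inv_norm A0 y"
    using inv_norm_lower_bound[OF A0] by blast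
  let ?P = "matrix_inv A0"
  note sym = inner_symmetric_matrix[OF sym_pos_defD(1)[OF sym_pos_def_matrix_inv[OF A0]]]
  have "\<bar>inv_norm A0 (z - b) - inv_norm A0 z\<bar> \<le> spectral_norm ?P / k * norm b" for z b
  proof -
    define \<alpha> \<beta> s where "\<alpha> = inv_norm A0 (z - b)" and "\<beta> = inv_norm A0 z" and "s = norm (z - b) + norm z"
    have s: "k * s \<le> \<alpha> + \<beta>"
      using k(2)[of "z - b"] k(2)[of z] by (simp add: \<alpha>_def \<beta>_def s_def distrib_left)
    have "\<alpha>\<^sup>2 - \<beta>\<^sup>2 = - (b \<bullet> (?P *v ((z - b) + z)))"
      unfolding \<alpha>_def \<beta>_def inv_norm_power2[OF A0]
      using sym[of z b] inner_commute[of "?P *v z" b]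
      by (simp only: matrix_vector_mult_diff_distrib matrix_vector_right_distrib inner_diff_left inner_diff_right
          inner_add_right)
    then have "\<bar>\<alpha>\<^sup>2 - \<beta>\<^sup>2\<bar> \<le> norm b * norm (?P *v ((z - b) + z))"
      by (simp only: abs_minus_cancel Cauchy_Schwarz_ineq2)
    also have "\<dots> \<le> norm b * (spectral_norm ?P * norm ((z - b) + z))"
      by (intro mult_left_mono norm_mult_vec_le) simp
    also have "\<dots> \<le> norm b * (spectral_norm ?P * s)"
      unfolding s_def by (intro mult_left_mono norm_triangle_ineq spectral_norm_nonneg) simp
    finally have sq: "\<bar>\<alpha> - \<beta>\<bar> * (\<alpha> + \<beta>) \<le> norm b * (spectral_norm ?P * s)"
      using inv_norm_nonneg[OF A0]
      by (simp add: power2_eq_square square_diff_square_factored abs_mult \<alpha>_def \<beta>_def mult.commute)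
    show ?thesis
    proof (cases "s = 0")
      case True
      then have "z = 0" "b = 0" by (auto simp: s_def add_nonneg_eq_0_iff)
      then show ?thesis by simp
    next
      case False
      then have "0 < s" by (simp add: s_def less_le)
      have "\<bar>\<alpha> - \<beta>\<bar> * (k * s) \<le> norm b * (spectral_norm ?P * s)"
        using mult_left_mono[OF s, of "\<bar>\<alpha> - \<beta>\<bar>"] sq by linarith
      then have "\<bar>\<alpha> - \<beta>\<bar> * k \<le> norm b * spectral_norm ?P"
        using \<open>0 < s\<close> by (simp add: mult.assoc[symmetric])
      then show ?thesis
        using k(1) by (simp add: \<alpha>_def \<beta>_def field_simps)
    qed
  qed
  moreover have "0 \<le> spectral_norm ?P / k" using k(1) spectral_norm_nonneg[of ?P] by simp
  ultimately show thesis by (intro that) blast+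
qed

lemma inv_norm_scaleR_matrix:
  fixes S :: "real ^ 'n ^ 'n"
  assumes c: "0 < c" and S: "invertible S"
  shows "inv_norm (c *\<^sub>R S) y = inv_norm S y / sqrt c"
proof -
  have cS: "(c *\<^sub>R S) *v x = c *\<^sub>R (S *v x)" for x
    by (simp add: scaleR_matrix_vector_assoc)
  have "invertible (c *\<^sub>R S)"
    unfolding invertible_left_inverse matrix_left_invertible_ker cS
    using c matrix_inv_mult_vec(2)[OF S] by (metis matrix_vector_mult_0_right scaleR_eq_0_iff less_irrefl)
  then have "c *\<^sub>R (S *v (matrix_inv (c *\<^sub>R S) *v y)) = y"
    using matrix_inv_mult_vec(1)[of "c *\<^sub>R S" y] by (simp only: cS)
  then have "matrix_inv S *v y = c *\<^sub>R (matrix_inv (c *\<^sub>R S) *v y)"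
    by (metis matrix_inv_mult_vec(2)[OF S] matrix_vector_mult_scaleR)
  then have "y \<bullet> (matrix_inv S *v y) = c * (y \<bullet> (matrix_inv (c *\<^sub>R S) *v y))"
    by simp
  then show ?thesis
    using c by (simp add: inv_norm_def real_sqrt_mult)
qed

lemma sym_pos_def_scaleR:
  assumes "0 < c" "sym_pos_def S"
  shows "sym_pos_def (c *\<^sub>R S)"
  using assms unfolding sym_pos_def_def
  by (simp add: scaleR_matrix_vector_assoc[symmetric] transpose_scalar)

section \<open>Exact identities for the estimators\<close>

lemma sample_mean_centered:
  assumes "0 < n"
  shows "sample_mean x n - \<mu> = (1 / real n) *\<^sub>R (\<Sum>i=1..n. x i - \<mu>)"
  using assms by (simp add: sample_mean_def sum_subtractf scaleR_diff_right sum_constant_scaleR del: sum_constant)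

lemma Sigma_hat_component:
  "Sigma_hat x n $ k $ l = 3 / real n * (\<Sum>i=1..n. (x i - sample_mean x n) $ k * (x i - sample_mean x n) $ l)"
  by (simp add: Sigma_hat_def outer_prod_def sum_component)

text \<open>The linear terms sum to multiples of the error of the mean, so centring at
  \<open>\<mu>\<close> instead of the sample mean costs only a product of two such errors.\<close>

lemma Sigma_hat_centered:
  assumes "0 < n"
  shows "Sigma_hat x n $ k $ l = 3 * ((1 / real n) * (\<Sum>i=1..n. (x i - \<mu>) $ k * (x i - \<mu>) $ l)
    - (sample_mean x n - \<mu>) $ k * (sample_mean x n - \<mu>) $ l)"
proof -
  define y where "y i = x i - \<mu>" for i
  define b where "b = sample_mean x n - \<mu>"
  have sum_y: "(\<Sum>i=1..n. y i $ j) = real n * b $ j" for j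
    using assms unfolding b_def sample_mean_centered[OF assms] y_def by (simp add: sum_component)
  have "(\<Sum>i=1..n. (x i - sample_mean x n) $ k * (x i - sample_mean x n) $ l)
      = (\<Sum>i=1..n. y i $ k * y i $ l - b $ l * y i $ k - b $ k * y i $ l + b $ k * b $ l)"
    by (intro sum.cong refl) (simp add: y_def b_def algebra_simps)
  also have "\<dots> = (\<Sum>i=1..n. y i $ k * y i $ l) - b $ l * (\<Sum>i=1..n. y i $ k) - b $ k * (\<Sum>i=1..n. y i $ l)
      + real n * (b $ k * b $ l)"
    by (simp add: sum.distrib sum_subtractf sum_distrib_left)
  also have "\<dots> = (\<Sum>i=1..n. y i $ k * y i $ l) - real n * (b $ k * b $ l)"
    unfolding sum_y by (simp add: algebra_simps)
  finally show ?thesis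
    using assms by (simp add: Sigma_hat_component y_def[symmetric] b_def[symmetric] field_simps)
qed

text \<open>The squared residuals average to a third of the trace of the identity, whatever the data.\<close>

lemma mean_xi_hat_square:
  assumes n: "0 < n" and pd: "\<And>v. v \<noteq> 0 \<Longrightarrow> 0 < v \<bullet> (Sigma_hat x n *v v)"
  shows "(1 / real n) * (\<Sum>j=1..n. (xi_hat x n j)\<^sup>2) = 1"
proof -
  let ?A = "Sigma_hat x n"
  define z where "z i = x i - sample_mean x n" for i
  have sym: "transpose ?A = ?A"
    by (simp add: transpose_def vec_eq_iff Sigma_hat_component mult.commute)
  then have "sym_pos_def ?A" using pd by (simp add: sym_pos_def_def)
  then have "(\<Sum>j=1..n. (xi_hat x n j)\<^sup>2) = (\<Sum>j=1..n. z j \<bullet> (matrix_inv ?A *v z j))"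
    by (simp add: xi_hat_def inv_norm_power2 z_def)
  also have "\<dots> = (\<Sum>j=1..n. \<Sum>k\<in>UNIV. \<Sum>l\<in>UNIV. matrix_inv ?A $ k $ l * (z j $ k * z j $ l))"
    by (simp add: inner_vec_def matrix_vector_mult_def sum_distrib_left mult_ac)
  \<comment> \<open>With the sum over the data innermost, each term becomes \<open>n / 3\<close>
    times an entry of \<open>Sigma_hat\<close>.\<close>
  also have "\<dots> = (\<Sum>k\<in>UNIV. \<Sum>l\<in>UNIV. \<Sum>j=1..n. matrix_inv ?A $ k $ l * (z j $ k * z j $ l))"
    by (subst sum.swap, rule sum.cong[OF refl], rule sum.swap)
  also have "\<dots> = (\<Sum>k\<in>UNIV. \<Sum>l\<in>UNIV. real n / 3 * (matrix_inv ?A $ k $ l * ?A $ k $ l))"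
    using n by (simp add: Sigma_hat_component z_def sum_distrib_left[symmetric])
  also have "\<dots> = real n / 3 * (\<Sum>k\<in>UNIV. \<Sum>l\<in>UNIV. matrix_inv ?A $ k $ l * ?A $ k $ l)"
    by (simp only: sum_distrib_left)
  also have "\<dots> = real n"
    using sum_matrix_inv_mult[OF sym pos_def_invertible[OF pd]] by simp
  finally show ?thesis using n by simp
qed

section \<open>From averages to the three estimators\<close>

text \<open>Deterministic, for one fixed sequence of data. The errors of the mean and of
  \<open>Sigma_hat\<close> come entrywise from the averages; for large \<open>n\<close>,
  \<open>sigma_sq_hat\<close> equals one minus the square of the mean residual, which approaches
  \<open>r / sqrt c\<close>.\<close>

lemma
  fixes x :: "nat \<Rightarrow> real ^ 3" and S :: "real ^ 3 ^ 3"
  assumes S: "sym_pos_def S" and c: "0 < c"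
    and mean: "\<And>k. (\<lambda>n. (1 / real n) * (\<Sum>i=1..n. (x i - \<mu>) $ k)) \<in> O(lil_rate)"
    and cov: "\<And>k l. (\<lambda>n. (1 / real n) * (\<Sum>i=1..n. (x i - \<mu>) $ k * (x i - \<mu>) $ l) - c / 3 * S $ k $ l) \<in> O(lil_rate)"
    and radius: "(\<lambda>n. (1 / real n) * (\<Sum>i=1..n. inv_norm S (x i - \<mu>)) - r) \<in> O(lil_rate)"
  shows sample_mean_lil: "(\<lambda>n. norm (sample_mean x n - \<mu>)) \<in> O(lil_rate)"
    and Sigma_hat_lil: "(\<lambda>n. spectral_norm (Sigma_hat x n - c *\<^sub>R S)) \<in> O(lil_rate)"
    and Sigma_hat_eventually_invertible: "\<forall>\<^sub>F n in sequentially. invertible (Sigma_hat x n)"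
    and sigma_sq_hat_lil: "(\<lambda>n. \<bar>sigma_sq_hat x n - (1 - r\<^sup>2 / c)\<bar>) \<in> O(lil_rate)"
proof -
  define y where "y i = x i - \<mu>" for i
  define b where "b n = sample_mean x n - \<mu>" for n
  define A0 where "A0 = c *\<^sub>R S"
  define d where "d n = spectral_norm (Sigma_hat x n - A0)" for n
  have b_comp: "(\<lambda>n. b n $ k) \<in> O(lil_rate)" for k
  proof -
    have "\<forall>\<^sub>F n in sequentially. b n $ k = (1 / real n) * (\<Sum>i=1..n. (x i - \<mu>) $ k)"
      using eventually_gt_at_top[of 0]
      by eventually_elim (simp add: b_def sample_mean_centered sum_component)
    from landau_o.big.in_cong[OF this] mean show ?thesis by simp
  qed
  have b_lil: "(\<lambda>n. norm (b n)) \<in> O(lil_rate)"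
  proof (rule bigo_of_eventually_abs_le)
    show "\<forall>\<^sub>F n in sequentially. \<bar>norm (b n)\<bar> \<le> (\<Sum>k\<in>UNIV. \<bar>b n $ k\<bar>)"
      by (simp add: norm_le_l1_cart)
    show "(\<lambda>n. \<Sum>k\<in>UNIV. \<bar>b n $ k\<bar>) \<in> O(lil_rate)"
      by (intro big_sum_in_bigo) (use b_comp in simp)
  qed
  then show "(\<lambda>n. norm (sample_mean x n - \<mu>)) \<in> O(lil_rate)" by (simp add: b_def)
  have entry: "(\<lambda>n. (Sigma_hat x n - A0) $ k $ l) \<in> O(lil_rate)" for k l
  proof -
    \<comment> \<open>The error of the average product, plus a product of two errors of the mean,
      one of which only has to be bounded.\<close>
    let ?e = "\<lambda>n. 3 * ((1 / real n) * (\<Sum>i=1..n. (x i - \<mu>) $ k * (x i - \<mu>) $ l) - c / 3 * S $ k $ l)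
      - 3 * (b n $ k * b n $ l)"
    have "(\<lambda>n. b n $ k * b n $ l) \<in> O(lil_rate)"
      by (intro lil_rate_mult b_comp lil_rate_bounded)
    moreover have "(\<lambda>n. 3 * f n) \<in> O(lil_rate)" if "f \<in> O(lil_rate)" for f :: "nat \<Rightarrow> real"
      using that by simp
    ultimately have "?e \<in> O(lil_rate)"
      using cov[of k l] by (intro sum_in_bigo)
    moreover have "\<forall>\<^sub>F n in sequentially. (Sigma_hat x n - A0) $ k $ l = ?e n"
      using eventually_gt_at_top[of 0]
      by eventually_elim (simp add: Sigma_hat_centered[where \<mu>=\<mu>] A0_def b_def algebra_simps)
    ultimately show ?thesis by (simp only: landau_o.big.in_cong)
  qed
  have d_lil: "d \<in> O(lil_rate)"
  proof (rule bigo_of_eventually_abs_le)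
    show "\<forall>\<^sub>F n in sequentially. \<bar>d n\<bar> \<le> (\<Sum>k\<in>UNIV. \<Sum>l\<in>UNIV. \<bar>(Sigma_hat x n - A0) $ k $ l\<bar>)"
      unfolding d_def by (intro always_eventually allI) (simp only: abs_of_nonneg spectral_norm_nonneg spectral_norm_le_sum)
    show "(\<lambda>n. \<Sum>k\<in>UNIV. \<Sum>l\<in>UNIV. \<bar>(Sigma_hat x n - A0) $ k $ l\<bar>) \<in> O(lil_rate)"
      by (intro big_sum_in_bigo) (simp only: landau_o.big.abs_in_iff entry)
  qed
  then show "(\<lambda>n. spectral_norm (Sigma_hat x n - c *\<^sub>R S)) \<in> O(lil_rate)"
    by (simp add: d_def[abs_def] A0_def)
  have A0: "sym_pos_def A0" unfolding A0_def by (rule sym_pos_def_scaleR[OF c S])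
  obtain m where m: "0 < m" "\<And>v. m * (norm v)\<^sup>2 \<le> v \<bullet> (A0 *v v)"
    using pos_def_coercive[of A0] sym_pos_defD(2)[OF A0] by metis
  \<comment> \<open>From some index on \<open>Sigma_hat\<close> is close enough to its limit to be
    positive definite and to admit the perturbation bounds.\<close>
  have "\<forall>\<^sub>F n in sequentially. d n < m / 2"
    using lil_rate_tendsto_0[OF d_lil] m(1) by (intro order_tendstoD) auto
  then have close: "\<forall>\<^sub>F n in sequentially. d n \<le> m / 2"
    by eventually_elim simp
  have pd: "0 < v \<bullet> (Sigma_hat x n *v v)" if "d n \<le> m / 2" "v \<noteq> 0" for n v
  proof -
    have "0 < m / 2 * (norm v)\<^sup>2" using m(1) that(2) by simp
    also have "\<dots> \<le> v \<bullet> (Sigma_hat x n *v v)"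
      using that(1) unfolding d_def by (intro pos_def_perturb[OF m(2)])
    finally show ?thesis .
  qed
  from close show "\<forall>\<^sub>F n in sequentially. invertible (Sigma_hat x n)"
    by eventually_elim (intro pos_def_invertible pd)
  obtain C where C: "0 \<le> C" "\<And>A z. spectral_norm (A - A0) \<le> m / 2 \<Longrightarrow>
    \<bar>inv_norm A z - inv_norm A0 z\<bar> \<le> C * spectral_norm (A - A0) * norm z"
    using inv_norm_perturb_matrix[OF A0 m] by blast
  obtain C' where C': "0 \<le> C'" "\<And>z v. \<bar>inv_norm A0 (z - v) - inv_norm A0 z\<bar> \<le> C' * norm v"
    using inv_norm_perturb_vector[OF A0] by blast
  obtain B where B: "0 < B" "\<And>z. norm z \<le> B * inv_norm S z"
    using norm_le_inv_norm[OF S] by blast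
  define R where "R n = (1 / real n) * (\<Sum>i=1..n. inv_norm S (y i))" for n
  have R_lil: "(\<lambda>n. R n - r) \<in> O(lil_rate)"
    using radius by (simp add: R_def y_def)
  define q where "q n = (1 / real n) * (\<Sum>j=1..n. xi_hat x n j)" for n
  \<comment> \<open>Two changes: first the matrix, at the vector \<open>y j - b n\<close>, then the
    vector, at the fixed matrix \<open>A0\<close>.\<close>
  have xi_le: "\<bar>xi_hat x n j - inv_norm S (y j) / sqrt c\<bar> \<le> C * d n * (B * inv_norm S (y j) + norm (b n)) + C' * norm (b n)"
    if "d n \<le> m / 2" for n j
  proof -
    have xi: "xi_hat x n j = inv_norm (Sigma_hat x n) (y j - b n)"
      by (simp add: xi_hat_def y_def b_def)
    have "\<bar>inv_norm (Sigma_hat x n) (y j - b n) - inv_norm A0 (y j - b n)\<bar> \<le> C * d n * norm (y j - b n)"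
      using C(2)[of "Sigma_hat x n"] that by (simp add: d_def)
    also have "\<dots> \<le> C * d n * (B * inv_norm S (y j) + norm (b n))"
      using norm_triangle_ineq4[of "y j" "b n"] B(2)[of "y j"] C(1)
      by (intro mult_left_mono) (auto simp: d_def spectral_norm_nonneg)
    finally show ?thesis
      using C'(2)[of "y j" "b n"] inv_norm_scaleR_matrix[OF c sym_pos_defD(3)[OF S], of "y j"]
      unfolding xi A0_def by linarith
  qed
  have "(\<lambda>n. q n - R n / sqrt c) \<in> O(lil_rate)"
  proof (rule bigo_of_eventually_abs_le)
    \<comment> \<open>Averaging the residual bounds leaves the mean length \<open>R n\<close>, which
      stays bounded, with \<open>d n\<close> as a factor.\<close>
    show "\<forall>\<^sub>F n in sequentially. \<bar>q n - R n / sqrt c\<bar> \<le> d n * (C * B * R n + C * norm (b n)) + C' * norm (b n)"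
      using close eventually_gt_at_top[of 0]
    proof eventually_elim
      case (elim n)
      have "q n - R n / sqrt c = (1 / real n) * (\<Sum>j=1..n. xi_hat x n j - inv_norm S (y j) / sqrt c)"
        by (simp add: q_def R_def sum_subtractf sum_divide_distrib[symmetric] diff_divide_distrib)
      then have "\<bar>q n - R n / sqrt c\<bar> = (1 / real n) * \<bar>\<Sum>j=1..n. xi_hat x n j - inv_norm S (y j) / sqrt c\<bar>"
        by (simp add: abs_mult)
      also have "\<dots> \<le> (1 / real n) * (\<Sum>j=1..n. \<bar>xi_hat x n j - inv_norm S (y j) / sqrt c\<bar>)"
        by (intro mult_left_mono sum_abs) simp
      also have "\<dots> \<le> (1 / real n) * (\<Sum>j=1..n. C * d n * (B * inv_norm S (y j) + norm (b n)) + C' * norm (b n))"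
        by (intro mult_left_mono sum_mono xi_le elim(1)) simp
      also have "(\<Sum>j=1..n. C * d n * (B * inv_norm S (y j) + norm (b n)) + C' * norm (b n))
          = C * d n * B * (\<Sum>j=1..n. inv_norm S (y j)) + real n * (C * d n * norm (b n) + C' * norm (b n))"
        by (simp add: sum.distrib sum_distrib_left algebra_simps)
      also have "(1 / real n) * \<dots> = d n * (C * B * R n + C * norm (b n)) + C' * norm (b n)"
        using elim(2) by (simp add: R_def field_simps)
      finally show ?case .
    qed
    have "R \<in> O(\<lambda>_. 1)" by (rule bounded_of_lil_rate_diff[OF R_lil])
    then have "(\<lambda>n. C * B * R n + C * norm (b n)) \<in> O(\<lambda>_. 1)"
      using lil_rate_bounded[OF b_lil] by (intro sum_in_bigo(1)) simp_all
    from lil_rate_mult[OF d_lil this]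
    show "(\<lambda>n. d n * (C * B * R n + C * norm (b n)) + C' * norm (b n)) \<in> O(lil_rate)"
      using b_lil by (intro sum_in_bigo(1)) simp_all
  qed
  moreover have "(\<lambda>n. (R n - r) * (1 / sqrt c)) \<in> O(lil_rate)"
    by (intro lil_rate_mult R_lil bigo_const_1)
  ultimately have "(\<lambda>n. (q n - R n / sqrt c) + (R n - r) * (1 / sqrt c)) \<in> O(lil_rate)"
    by (rule sum_in_bigo)
  then have q_lil: "(\<lambda>n. q n - r / sqrt c) \<in> O(lil_rate)"
    by (simp add: diff_divide_distrib)
  have "(\<lambda>n. q n + r / sqrt c) \<in> O(\<lambda>_. 1)"
    by (intro sum_in_bigo bounded_of_lil_rate_diff[OF q_lil] bigo_const_1)
  then have "(\<lambda>n. (q n - r / sqrt c) * (q n + r / sqrt c)) \<in> O(lil_rate)"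
    by (rule lil_rate_mult[OF q_lil])
  then have prod: "(\<lambda>n. \<bar>(q n - r / sqrt c) * (q n + r / sqrt c)\<bar>) \<in> O(lil_rate)"
    by (simp only: landau_o.big.abs_in_iff)
  have "\<forall>\<^sub>F n in sequentially. \<bar>\<bar>sigma_sq_hat x n - (1 - r\<^sup>2 / c)\<bar>\<bar> \<le> \<bar>(q n - r / sqrt c) * (q n + r / sqrt c)\<bar>"
    using close eventually_gt_at_top[of 0]
  proof eventually_elim
    case (elim n)
    \<comment> \<open>The squared residuals average exactly to one, so the error is a difference of
      two squares.\<close>
    have "sigma_sq_hat x n = 1 - (q n)\<^sup>2"
      unfolding sigma_sq_hat_def q_def using mean_xi_hat_square[OF elim(2) pd[OF elim(1)]] by simp
    moreover have "(q n - r / sqrt c) * (q n + r / sqrt c) = (q n)\<^sup>2 - (r / sqrt c)\<^sup>2"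
      by (simp add: power2_eq_square algebra_simps)
    moreover have "(r / sqrt c)\<^sup>2 = r\<^sup>2 / c"
      using c by (simp add: power_divide)
    ultimately show ?case by (simp add: abs_minus_commute)
  qed
  from this prod show "(\<lambda>n. \<bar>sigma_sq_hat x n - (1 - r\<^sup>2 / c)\<bar>) \<in> O(lil_rate)"
    by (rule bigo_of_eventually_abs_le)
qed

section \<open>Almost sure rates of the estimators\<close>

theorem theorem3p1:
  fixes M :: "'a measure"
    and X :: "nat \<Rightarrow> 'a \<Rightarrow> real ^ 3"
    and \<mu> :: "real ^ 3"
    and S :: "real ^ 3 ^ 3"
    and \<sigma> :: real
  assumes "prob_space M"
    and "sym_pos_def S"
    and "\<sigma> > 0"
    and "prob_space.indep_vars M (\<lambda>_. borel) X {1..}"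
    and "\<And>i. i \<ge> 1 \<Longrightarrow> distributed M lborel (X i) (\<lambda>x. ennreal (ellipsoidal_density \<mu> S \<sigma> x))"
  shows "(AE \<omega> in M. (\<lambda>n. norm (sample_mean (\<lambda>i. X i \<omega>) n - \<mu>)) \<in> O(lil_rate)) \<and>
         (AE \<omega> in M. (\<lambda>n. spectral_norm (Sigma_hat (\<lambda>i. X i \<omega>) n - Sigma_star S \<sigma>)) \<in> O(lil_rate)) \<and>
         (AE \<omega> in M. (\<forall>\<^sub>F n in sequentially. invertible (Sigma_hat (\<lambda>i. X i \<omega>) n)) \<and>
                     (\<lambda>n. \<bar>sigma_sq_hat (\<lambda>i. X i \<omega>) n - sigma_sq_tilde \<sigma>\<bar>) \<in> O(lil_rate))"
proof -
  interpret prob_space M by fact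
  note S = \<open>sym_pos_def S\<close> and \<sigma> = \<open>\<sigma> > 0\<close>
  let ?D = "ellipsoidal_law S \<sigma>"
  \<comment> \<open>\<open>c\<close> is the factor in \<open>Sigma_star\<close> and \<open>r\<close>
    the mean length of a centred observation; \<open>1 - r\<^sup>2 / c\<close> is then
    \<open>sigma_sq_tilde\<close>.\<close>
  define c where "c = J_int 4 \<sigma> / J_int 2 \<sigma>"
  define r where "r = J_int 3 \<sigma> / J_int 2 \<sigma>"
  have J: "0 < J_int k \<sigma>" for k by (rule J_int_pos[OF \<sigma>])
  have c: "0 < c" using J by (simp add: c_def)
  have law: "distr M borel (\<lambda>\<omega>. X i \<omega> - \<mu>) = ?D" if "1 \<le> i" for i
    using that by (intro distr_ellipsoidal_density_centered assms(5))
  have "prob_space (distr M borel (\<lambda>\<omega>. X 1 \<omega> - \<mu>))"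
    using assms(5)[of 1] by (intro prob_space_distr) (auto simp: distributed_def)
  then have D: "prob_space ?D" by (simp only: law[OF order_refl])
  have lil: "AE \<omega> in M. (\<lambda>n. (1 / real n) * (\<Sum>i=1..n. h (X i \<omega> - \<mu>)) - (\<integral>y. h y \<partial>?D)) \<in> O(lil_rate)"
    if "h \<in> borel_measurable borel" "\<And>y. \<bar>h y\<bar> \<le> A + B * (inv_norm S y)\<^sup>2" "0 \<le> B" for h A B
    by (rule lil_ellipsoidal_law[OF S \<sigma> assms(4) law that])
  obtain B where B: "0 < B" "\<And>y. norm y \<le> B * inv_norm S y"
    using norm_le_inv_norm[OF S] by blast
  \<comment> \<open>From \<open>(u - 1 / 2)\<^sup>2 \<ge> 0\<close>; it brings functions of linear
    growth under the quadratic growth condition.\<close>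
  have lin_quad: "u \<le> 1 + u\<^sup>2" for u :: real
    using sum_power2_ge_zero[of "u - 1 / 2" 0] by (simp add: power2_eq_square algebra_simps)
  have comp: "\<bar>y $ k\<bar> \<le> B * inv_norm S y" for y k
    using component_le_norm_cart[of y k] B(2)[of y] by linarith
  have mean: "AE \<omega> in M. (\<lambda>n. (1 / real n) * (\<Sum>i=1..n. (X i \<omega> - \<mu>) $ k)) \<in> O(lil_rate)" for k
  proof -
    have "\<bar>y $ k\<bar> \<le> B + B * (inv_norm S y)\<^sup>2" for y
      using comp[of y k] mult_left_mono[OF lin_quad[of "inv_norm S y"], of B] B(1)
      by (simp add: algebra_simps)
    from lil[OF _ this] B(1) show ?thesis
      by (simp add: integral_ellipsoidal_law_component)
  qed
  have cov: "AE \<omega> in M. (\<lambda>n. (1 / real n) * (\<Sum>i=1..n. (X i \<omega> - \<mu>) $ k * (X i \<omega> - \<mu>) $ l) - c / 3 * S $ k $ l)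
      \<in> O(lil_rate)" for k l
  proof -
    have growth: "\<bar>y $ k * y $ l\<bar> \<le> 0 + B\<^sup>2 * (inv_norm S y)\<^sup>2" for y
      using mult_mono[OF comp[of y k] comp[of y l]] B(1) inv_norm_nonneg[OF S, of y]
      by (simp add: abs_mult power2_eq_square mult_ac)
    \<comment> \<open>The dimension 3 turns the indices into 4 and 2; the divisor 3 is what the
      factor 3 in \<open>Sigma_hat\<close> compensates.\<close>
    have integral: "(\<integral>y. y $ k * y $ l \<partial>?D) = c / 3 * S $ k $ l"
      using integral_ellipsoidal_law_covariance[OF S \<sigma> D, of k l] by (simp add: c_def)
    show ?thesis
      using lil[OF _ growth, unfolded integral] by simp
  qed
  have radius: "AE \<omega> in M. (\<lambda>n. (1 / real n) * (\<Sum>i=1..n. inv_norm S (X i \<omega> - \<mu>)) - r) \<in> O(lil_rate)"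
  proof -
    have "(\<integral>y. inv_norm S y \<partial>?D) = r"
      using integral_inv_norm_power[OF S \<sigma> D, of 1] by (simp add: r_def)
    moreover have "\<bar>inv_norm S y\<bar> \<le> 1 + 1 * (inv_norm S y)\<^sup>2" for y
      using lin_quad[of "inv_norm S y"] inv_norm_nonneg[OF S, of y] by simp
    ultimately show ?thesis
      using lil[of "inv_norm S" 1 1] by simp
  qed
  \<comment> \<open>There are finitely many coordinates and pairs of them, so one null set serves
    for all and the deterministic argument runs on its complement.\<close>
  have "AE \<omega> in M. \<forall>k. (\<lambda>n. (1 / real n) * (\<Sum>i=1..n. (X i \<omega> - \<mu>) $ k)) \<in> O(lil_rate)"
    using mean by (intro AE_all_countable[THEN iffD2]) auto
  moreover have "AE \<omega> in M. \<forall>k l. (\<lambda>n. (1 / real n) * (\<Sum>i=1..n. (X i \<omega> - \<mu>) $ k * (X i \<omega> - \<mu>) $ l) - c / 3 * S $ k $ l)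
      \<in> O(lil_rate)"
    using cov by (simp only: AE_all_countable) auto
  ultimately have "AE \<omega> in M.
      (\<lambda>n. norm (sample_mean (\<lambda>i. X i \<omega>) n - \<mu>)) \<in> O(lil_rate) \<and>
      (\<lambda>n. spectral_norm (Sigma_hat (\<lambda>i. X i \<omega>) n - c *\<^sub>R S)) \<in> O(lil_rate) \<and>
      (\<forall>\<^sub>F n in sequentially. invertible (Sigma_hat (\<lambda>i. X i \<omega>) n)) \<and>
      (\<lambda>n. \<bar>sigma_sq_hat (\<lambda>i. X i \<omega>) n - (1 - r\<^sup>2 / c)\<bar>) \<in> O(lil_rate)"
    using radius
  proof eventually_elim
    case (elim \<omega>)
    note * = S c elim(1)[rule_format] elim(2)[rule_format] elim(3)
    show ?case
      using sample_mean_lil[OF *] Sigma_hat_lil[OF *] Sigma_hat_eventually_invertible[OF *]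
        sigma_sq_hat_lil[OF *] by blast
  qed
  moreover have "c *\<^sub>R S = Sigma_star S \<sigma>" by (simp add: Sigma_star_def c_def)
  moreover have "1 - r\<^sup>2 / c = sigma_sq_tilde \<sigma>"
    using J[of 2] J[of 4] by (simp add: sigma_sq_tilde_def r_def c_def field_simps power2_eq_square)
  ultimately show ?thesis
    by (simp only: AE_conj_iff)
qed

end
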